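(* (In $\mathrm{ZF}$.) A cardinal $\delta$ is proto Berkeley if and only if for any graph $(G,E)$ such that $\aleph(G)>\delta$ and any injection $f:\delta\rightarrow G$, there is an endomorphism $h:(G,E)\rightarrow(G,E)$ such that $h\vert_{\operatorname{range}(f)}\neq \mathrm{id}$.
   Context: The base theory is $\mathrm{ZF}$, without the Axiom of Choice; cardinals here are initial ordinals. A cardinal $\delta$ is proto Berkeley if for every transitive set $M$ with $\delta\in M$ there is a nontrivial elementary embedding $j:M\rightarrow M$ (for the language $\{\in\}$) with critical point (least ordinal moved) strictly below $\delta$. A graph $(G,E)$ is a directed graph: a set $G$ with a binary relation $E\subseteq G\times G$. An endomorphism $h:(G,E)\to(G,E)$ is a map $h:G\to G$ such that $(x,y)\in E$ implies $(h(x),h(y))\in E$ for all $x,y\in G$. The Hartogs number $\aleph(X)$ of a set $X$ is the least ordinal $\alpha$ such that there is no injection from $\alpha$ into $X$. *)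

theory Defs
  imports Main
begin

text \<open>
  HOL proves the Axiom of Choice, so ``in ZF'' cannot mean ``about HOL sets''. Instead, the theorem
  is stated for an arbitrary structure \<open>(V, mem)\<close> satisfying the first-order axioms of ZF, where
  \<open>V\<close> is the universe of an arbitrary type; by the completeness theorem this is the same as
  provability in ZF. The axiom schemas range only over first-order formulas with parameters: with
  schemas over all HOL predicates, Choice of HOL would make the structure satisfy Choice.
\<close>

datatype fm =
    FMem nat nat
  | FEq nat nat
  | FNeg fm
  | FAnd fm fm
  | FEx nat fm

primrec holds :: "('a \<Rightarrow> 'a \<Rightarrow> bool) \<Rightarrow> (nat \<Rightarrow> 'a) \<Rightarrow> fm \<Rightarrow> bool" where
  "holds mem e (FMem m n) \<longleftrightarrow> mem (e m) (e n)"
| "holds mem e (FEq m n) \<longleftrightarrow> e m = e n"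
| "holds mem e (FNeg p) \<longleftrightarrow> \<not> holds mem e p"
| "holds mem e (FAnd p q) \<longleftrightarrow> holds mem e p \<and> holds mem e q"
| "holds mem e (FEx n p) \<longleftrightarrow> (\<exists>x. holds mem (e(n := x)) p)"

text \<open>
  In the schemas, variable 0 (and 1 in replacement) are the arguments of the formula, and the
  assignment \<open>e\<close> supplies arbitrary parameters for all other variables.
\<close>

locale zf =
  fixes mem :: "'a \<Rightarrow> 'a \<Rightarrow> bool"  (infix \<open>\<epsilon>\<close> 50)
  assumes extensionality: "\<And>x y. (\<forall>z. z \<epsilon> x \<longleftrightarrow> z \<epsilon> y) \<Longrightarrow> x = y"
    and foundation: "\<And>x. \<exists>z. z \<epsilon> x \<Longrightarrow> \<exists>y. y \<epsilon> x \<and> \<not> (\<exists>z. z \<epsilon> x \<and> z \<epsilon> y)"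
    and pairing: "\<And>a b. \<exists>c. \<forall>z. z \<epsilon> c \<longleftrightarrow> z = a \<or> z = b"
    and union: "\<And>x. \<exists>u. \<forall>z. z \<epsilon> u \<longleftrightarrow> (\<exists>y. y \<epsilon> x \<and> z \<epsilon> y)"
    and power_set: "\<And>x. \<exists>p. \<forall>y. y \<epsilon> p \<longleftrightarrow> (\<forall>z. z \<epsilon> y \<longrightarrow> z \<epsilon> x)"
    and infinity: "\<exists>w. (\<exists>x. x \<epsilon> w \<and> (\<forall>z. \<not> z \<epsilon> x)) \<and>
        (\<forall>x. x \<epsilon> w \<longrightarrow> (\<exists>y. y \<epsilon> w \<and> (\<forall>z. z \<epsilon> y \<longleftrightarrow> z \<epsilon> x \<or> z = x)))"
    and separation: "\<And>\<phi> e A. \<exists>B. \<forall>x. x \<epsilon> B \<longleftrightarrow> x \<epsilon> A \<and> holds mem (e(0 := x)) \<phi>"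
    and replacement: "\<And>\<phi> e A.
        (\<And>x y y'. x \<epsilon> A \<Longrightarrow> holds mem (e(0 := x, 1 := y)) \<phi> \<Longrightarrow>
            holds mem (e(0 := x, 1 := y')) \<phi> \<Longrightarrow> y = y') \<Longrightarrow>
        \<exists>B. \<forall>y. y \<epsilon> B \<longleftrightarrow> (\<exists>x. x \<epsilon> A \<and> holds mem (e(0 := x, 1 := y)) \<phi>)"

text \<open>
  The set-theoretic notions are interpreted inside \<open>(V, mem)\<close>: their quantifiers range over
  elements of the structure, so functions, relations, natural numbers and formulas are
  \<open>mem\<close>-sets (and \<open>\<omega>\<close> need not be standard). The definitions need no axioms, but their
  descriptions denote as intended only in a model of ZF.
\<close>

locale membership =
  fixes mem :: "'a \<Rightarrow> 'a \<Rightarrow> bool"  (infix \<open>\<epsilon>\<close> 50)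
begin

definition elts :: "'a \<Rightarrow> 'a set" where
  "elts A = {x. x \<epsilon> A}"

text \<open>Only meaningful when \<open>{x. P x}\<close> is the extension of an element of the structure.\<close>

definition the_set :: "('a \<Rightarrow> bool) \<Rightarrow> 'a" where
  "the_set P = (THE A. elts A = {x. P x})"

definition zero :: 'a where
  "zero = the_set (\<lambda>_. False)"

definition succ :: "'a \<Rightarrow> 'a" where
  "succ x = the_set (\<lambda>z. z \<epsilon> x \<or> z = x)"

definition upair :: "'a \<Rightarrow> 'a \<Rightarrow> 'a" where
  "upair a b = the_set (\<lambda>z. z = a \<or> z = b)"

definition opair :: "'a \<Rightarrow> 'a \<Rightarrow> 'a" where
  "opair a b = upair (upair a a) (upair a b)"

definition omega :: 'a where
  "omega = the_set (\<lambda>n. \<forall>w. zero \<epsilon> w \<and> (\<forall>x\<in>elts w. succ x \<epsilon> w) \<longrightarrow> n \<epsilon> w)"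

definition is_fun :: "'a \<Rightarrow> 'a \<Rightarrow> 'a \<Rightarrow> bool" where
  "is_fun f A B \<longleftrightarrow>
     (\<forall>z\<in>elts f. \<exists>x\<in>elts A. \<exists>y\<in>elts B. z = opair x y) \<and>
     (\<forall>x\<in>elts A. \<exists>!y. opair x y \<epsilon> f)"

definition app :: "'a \<Rightarrow> 'a \<Rightarrow> 'a" where
  "app f x = (THE y. opair x y \<epsilon> f)"

definition is_injection :: "'a \<Rightarrow> 'a \<Rightarrow> 'a \<Rightarrow> bool" where
  "is_injection f A B \<longleftrightarrow> is_fun f A B \<and> inj_on (app f) (elts A)"

definition is_bijection :: "'a \<Rightarrow> 'a \<Rightarrow> 'a \<Rightarrow> bool" where
  "is_bijection f A B \<longleftrightarrow> is_fun f A B \<and> bij_betw (app f) (elts A) (elts B)"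

definition transitive :: "'a \<Rightarrow> bool" where
  "transitive A \<longleftrightarrow> (\<forall>x\<in>elts A. elts x \<subseteq> elts A)"

text \<open>By foundation, these are exactly the transitive sets well-ordered by membership.\<close>

definition is_ordinal :: "'a \<Rightarrow> bool" where
  "is_ordinal \<alpha> \<longleftrightarrow> transitive \<alpha> \<and> (\<forall>x\<in>elts \<alpha>. transitive x)"

definition is_cardinal :: "'a \<Rightarrow> bool" where
  "is_cardinal \<kappa> \<longleftrightarrow>
     is_ordinal \<kappa> \<and> \<not> (\<exists>\<alpha>\<in>elts \<kappa>. \<exists>f. is_bijection f \<alpha> \<kappa>)"

text \<open>For ordinals, \<open>\<beta> < \<alpha>\<close> is \<open>\<beta> \<epsilon> \<alpha>\<close>.\<close>

definition hartogs :: "'a \<Rightarrow> 'a" where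
  "hartogs X = (THE \<alpha>. is_ordinal \<alpha> \<and> \<not> (\<exists>f. is_injection f \<alpha> X) \<and>
     (\<forall>\<beta>\<in>elts \<alpha>. \<exists>f. is_injection f \<beta> X))"

text \<open>Codes for the formulas of the language of set theory, with variables indexed by \<open>omega\<close>.\<close>

definition code_mem :: "'a \<Rightarrow> 'a \<Rightarrow> 'a" where
  "code_mem m n = opair zero (opair m n)"

definition code_eq :: "'a \<Rightarrow> 'a \<Rightarrow> 'a" where
  "code_eq m n = opair (succ zero) (opair m n)"

definition code_neg :: "'a \<Rightarrow> 'a" where
  "code_neg p = opair (succ (succ zero)) p"

definition code_and :: "'a \<Rightarrow> 'a \<Rightarrow> 'a" where
  "code_and p q = opair (succ (succ (succ zero))) (opair p q)"

definition code_ex :: "'a \<Rightarrow> 'a \<Rightarrow> 'a" where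
  "code_ex n p = opair (succ (succ (succ (succ zero)))) (opair n p)"

definition formula_closed :: "'a \<Rightarrow> bool" where
  "formula_closed X \<longleftrightarrow>
     (\<forall>m\<in>elts omega. \<forall>n\<in>elts omega. code_mem m n \<epsilon> X \<and> code_eq m n \<epsilon> X) \<and>
     (\<forall>p\<in>elts X. code_neg p \<epsilon> X) \<and>
     (\<forall>p\<in>elts X. \<forall>q\<in>elts X. code_and p q \<epsilon> X) \<and>
     (\<forall>n\<in>elts omega. \<forall>p\<in>elts X. code_ex n p \<epsilon> X)"

definition is_formula :: "'a \<Rightarrow> bool" where
  "is_formula p \<longleftrightarrow> (\<forall>X. formula_closed X \<longrightarrow> p \<epsilon> X)"

text \<open>
  \<open>S\<close> contains the pair of a formula \<open>p\<close> and an assignment \<open>a : omega \<rightarrow> M\<close> iff \<open>p\<close> is true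
  in \<open>(M, \<epsilon>)\<close> under \<open>a\<close>. In ZF such an \<open>S\<close> exists for every \<open>M\<close>, and any two agree on all
  formulas and assignments.
\<close>

definition satisfaction_relation :: "'a \<Rightarrow> 'a \<Rightarrow> bool" where
  "satisfaction_relation M S \<longleftrightarrow> (\<forall>a. is_fun a omega M \<longrightarrow>
     (\<forall>m\<in>elts omega. \<forall>n\<in>elts omega.
        (opair (code_mem m n) a \<epsilon> S \<longleftrightarrow> app a m \<epsilon> app a n) \<and>
        (opair (code_eq m n) a \<epsilon> S \<longleftrightarrow> app a m = app a n)) \<and>
     (\<forall>p. is_formula p \<longrightarrow>
        (opair (code_neg p) a \<epsilon> S \<longleftrightarrow> \<not> opair p a \<epsilon> S)) \<and>
     (\<forall>p q. is_formula p \<and> is_formula q \<longrightarrow>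
        (opair (code_and p q) a \<epsilon> S \<longleftrightarrow> opair p a \<epsilon> S \<and> opair q a \<epsilon> S)) \<and>
     (\<forall>p. \<forall>n\<in>elts omega. is_formula p \<longrightarrow>
        (opair (code_ex n p) a \<epsilon> S \<longleftrightarrow>
           (\<exists>b. is_fun b omega M \<and> (\<forall>k\<in>elts omega. k \<noteq> n \<longrightarrow> app b k = app a k) \<and>
              opair p b \<epsilon> S))))"

definition satisfies :: "'a \<Rightarrow> 'a \<Rightarrow> 'a \<Rightarrow> bool" where
  "satisfies M p a \<longleftrightarrow> (\<exists>S. satisfaction_relation M S \<and> opair p a \<epsilon> S)"

text \<open>Below, \<open>b\<close> is the assignment \<open>j \<circ> a\<close>.\<close>

definition elementary_embedding :: "'a \<Rightarrow> 'a \<Rightarrow> 'a \<Rightarrow> bool" where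
  "elementary_embedding j M N \<longleftrightarrow> is_fun j M N \<and>
     (\<forall>p a b. is_formula p \<and> is_fun a omega M \<and> is_fun b omega N \<and>
        (\<forall>k\<in>elts omega. app b k = app j (app a k)) \<longrightarrow>
        (satisfies M p a \<longleftrightarrow> satisfies N p b))"

definition is_critical_point :: "'a \<Rightarrow> 'a \<Rightarrow> 'a \<Rightarrow> bool" where
  "is_critical_point j M \<kappa> \<longleftrightarrow>
     is_ordinal \<kappa> \<and> \<kappa> \<epsilon> M \<and> app j \<kappa> \<noteq> \<kappa> \<and>
     (\<forall>\<alpha>\<in>elts M. is_ordinal \<alpha> \<and> \<alpha> \<epsilon> \<kappa> \<longrightarrow> app j \<alpha> = \<alpha>)"

definition proto_berkeley :: "'a \<Rightarrow> bool" where
  "proto_berkeley \<delta> \<longleftrightarrow> is_cardinal \<delta> \<and>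
     (\<forall>M. transitive M \<and> \<delta> \<epsilon> M \<longrightarrow>
        (\<exists>j. elementary_embedding j M M \<and> (\<exists>x\<in>elts M. app j x \<noteq> x) \<and>
           (\<exists>\<kappa>. is_critical_point j M \<kappa> \<and> \<kappa> \<epsilon> \<delta>)))"

definition is_graph :: "'a \<Rightarrow> 'a \<Rightarrow> bool" where
  "is_graph G R \<longleftrightarrow> (\<forall>e\<in>elts R. \<exists>x\<in>elts G. \<exists>y\<in>elts G. e = opair x y)"

definition is_endomorphism :: "'a \<Rightarrow> 'a \<Rightarrow> 'a \<Rightarrow> bool" where
  "is_endomorphism h G R \<longleftrightarrow> is_fun h G G \<and>
     (\<forall>x\<in>elts G. \<forall>y\<in>elts G. opair x y \<epsilon> R \<longrightarrow> opair (app h x) (app h y) \<epsilon> R)"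

end

end

theory Submission
  imports Defs
begin

text \<open>
  Suppose \<open>\<delta>\<close> is proto Berkeley. Choose a transitive \<open>M\<close> in which \<open>(G, R, f, \<delta>)\<close> is a definable
  point; every elementary \<open>j : M \<rightarrow> M\<close> then fixes \<open>G\<close>, \<open>R\<close> and \<open>f\<close>, so \<open>j\<close> restricts to an
  endomorphism of the graph, and it moves \<open>f(\<kappa>)\<close> for the critical point \<open>\<kappa> < \<delta>\<close> because
  \<open>j(f(\<kappa>)) = f(j(\<kappa>))\<close>.

  Conversely, given a transitive \<open>M\<close> containing \<open>\<delta>\<close>, take a set \<open>A\<close> closed under pairing that contains
  \<open>M\<close>, \<open>\<omega>\<close> and all assignments \<open>\<omega> \<rightarrow> M\<close>. Finitely many binary relations on \<open>A\<close> suffice to make every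
  map preserving them fix all formulas, act on assignments by composition and preserve truth;
  preserving truth of negations as well, it is elementary on \<open>M\<close>. These relations are coded in a single
  graph whose only triangles lie in a finite rigid tournament of colours, so that every endomorphism
  respects the coding. An endomorphism moving some \<open>\<alpha> < \<delta>\<close> yields an embedding whose critical point is
  the least such \<open>\<alpha>\<close>.

  All sets used must be obtained from first-order instances of separation and replacement, which is
  why definability is tracked explicitly.
\<close>

subsection \<open>Definability with parameters\<close>

primrec rename :: "(nat \<Rightarrow> nat) \<Rightarrow> fm \<Rightarrow> fm" where
  "rename \<sigma> (FMem m n) = FMem (\<sigma> m) (\<sigma> n)"
| "rename \<sigma> (FEq m n) = FEq (\<sigma> m) (\<sigma> n)"
| "rename \<sigma> (FNeg p) = FNeg (rename \<sigma> p)"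
| "rename \<sigma> (FAnd p q) = FAnd (rename \<sigma> p) (rename \<sigma> q)"
| "rename \<sigma> (FEx n p) = FEx (\<sigma> n) (rename \<sigma> p)"

text \<open>Bound variables are renamed along with free ones, so injectivity of
  \<open>\<sigma>\<close> is what rules out capture: updating the value at \<open>\<sigma> n\<close>
  changes no other \<open>\<sigma> i\<close>.\<close>

lemma holds_rename:
  assumes "inj \<sigma>"
  shows "holds mem e (rename \<sigma> p) \<longleftrightarrow> holds mem (\<lambda>i. e (\<sigma> i)) p"
proof (induction p arbitrary: e)
  case (FEx n p)
  have "(\<lambda>i. (e(\<sigma> n := x)) (\<sigma> i)) = (\<lambda>i. e (\<sigma> i))(n := x)" for x
    using assms by (auto simp: fun_eq_iff inj_eq)
  then show ?case using FEx by simp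
qed auto

text \<open>Both halves stay infinite, so a formula can mention any argument and any parameter, and
  two parameter lists can be merged by interleaving once more.\<close>

definition mix :: "(nat \<Rightarrow> 'a) \<Rightarrow> (nat \<Rightarrow> 'a) \<Rightarrow> nat \<Rightarrow> 'a" where
  "mix e \<rho> i = (if even i then e (i div 2) else \<rho> (i div 2))"

lemma mix_even [simp]: "mix e \<rho> (2 * i) = e i"
  and mix_odd [simp]: "mix e \<rho> (Suc (2 * i)) = \<rho> i"
  and mix_0 [simp]: "mix e \<rho> 0 = e 0"
  and mix_1 [simp]: "mix e \<rho> (Suc 0) = \<rho> 0"
  by (auto simp: mix_def)

lemma mix_cases: "(\<And>k. i = 2 * k \<Longrightarrow> thesis) \<Longrightarrow> (\<And>k. i = Suc (2 * k) \<Longrightarrow> thesis) \<Longrightarrow> thesis" for i :: nat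
  by (metis evenE oddE Suc_eq_plus1)

lemma mix_eqI: "(\<And>k. f (2 * k) = g (2 * k)) \<Longrightarrow> (\<And>k. f (Suc (2 * k)) = g (Suc (2 * k))) \<Longrightarrow> f = g"
  for f g :: "nat \<Rightarrow> 'b"
  by (metis ext mix_cases)

lemma inj_mixI:
  fixes \<sigma> :: "nat \<Rightarrow> nat"
  assumes "\<And>k l. \<sigma> (2 * k) = \<sigma> (2 * l) \<Longrightarrow> k = l"
    and "\<And>k l. \<sigma> (Suc (2 * k)) = \<sigma> (Suc (2 * l)) \<Longrightarrow> k = l"
    and "\<And>k l. \<sigma> (2 * k) \<noteq> \<sigma> (Suc (2 * l))"
  shows "inj \<sigma>"
proof (rule injI)
  fix i j assume "\<sigma> i = \<sigma> j"
  then show "i = j"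
    by (cases i rule: mix_cases; cases j rule: mix_cases) (metis assms)+
qed

locale zf_universe = zf mem + membership mem
  for mem :: "'a \<Rightarrow> 'a \<Rightarrow> bool"  (infix \<open>\<epsilon>\<close> 50)
begin

text \<open>
  Environments are read as de Bruijn stacks: entering a quantifier pushes the bound value, so the
  old variable \<open>i\<close> becomes \<open>Suc i\<close>. Parameters occupy the odd variables of the witnessing formula.
\<close>

definition definable :: "((nat \<Rightarrow> 'a) \<Rightarrow> bool) \<Rightarrow> bool" where
  "definable P \<longleftrightarrow> (\<exists>\<phi> \<rho>. \<forall>e. P e \<longleftrightarrow> holds mem (mix e \<rho>) \<phi>)"

text \<open>The language has no function symbols, so a term enters through its graph: the value is
  variable 0 and the arguments are pushed up by one.\<close>

definition definable_term :: "((nat \<Rightarrow> 'a) \<Rightarrow> 'a) \<Rightarrow> bool" where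
  "definable_term t \<longleftrightarrow> definable (\<lambda>e. e 0 = t (\<lambda>i. e (Suc i)))"

named_theorems dfn

section \<open>Closure of definability under renaming, connectives and quantifiers\<close>

lemma definable_rename:
  assumes "definable P" "inj \<tau>"
  shows "definable (\<lambda>e. P (\<lambda>i. e (\<tau> i)))"
proof -
  obtain \<phi> \<rho> where P: "\<And>e. P e \<longleftrightarrow> holds mem (mix e \<rho>) \<phi>"
    using assms(1) unfolding definable_def by blast
  \<comment> \<open>\<open>\<tau>\<close> acts on the even variables only; the odd ones, which hold
    the parameters, stay in place.\<close>
  define \<sigma> where "\<sigma> = mix (\<lambda>i. 2 * \<tau> i) (\<lambda>i. Suc (2 * i))"
  have "inj \<sigma>"
    by (rule inj_mixI) (use assms(2) in \<open>auto simp: \<sigma>_def inj_eq, presburger\<close>)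
  moreover have "(\<lambda>i. mix e \<rho> (\<sigma> i)) = mix (\<lambda>i. e (\<tau> i)) \<rho>" for e
    by (rule mix_eqI) (auto simp: \<sigma>_def)
  ultimately show ?thesis
    unfolding definable_def P by (metis holds_rename)
qed

lemma definable_neg [dfn]: "definable P \<Longrightarrow> definable (\<lambda>e. \<not> P e)"
  unfolding definable_def by (metis holds.simps(3))

lemma definable_conj [dfn]:
  assumes "definable P" "definable Q"
  shows "definable (\<lambda>e. P e \<and> Q e)"
proof -
  obtain \<phi> \<rho> \<psi> \<rho>' where P: "\<And>e. P e \<longleftrightarrow> holds mem (mix e \<rho>) \<phi>"
    and Q: "\<And>e. Q e \<longleftrightarrow> holds mem (mix e \<rho>') \<psi>"
    using assms unfolding definable_def by blast
  \<comment> \<open>The two formulas come with unrelated parameters.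
    \<open>mix \<rho> \<rho>'\<close> stores both lists, and \<open>\<sigma>\<close>,
    \<open>\<tau>\<close> send the odd variables of each formula to its own list.\<close>
  define \<sigma> \<tau> :: "nat \<Rightarrow> nat" where "\<sigma> = mix (\<lambda>i. 2 * i) (\<lambda>i. Suc (2 * (2 * i)))"
    and "\<tau> = mix (\<lambda>i. 2 * i) (\<lambda>i. Suc (2 * Suc (2 * i)))"
  have "inj \<sigma>" "inj \<tau>"
    by (rule inj_mixI; simp add: \<sigma>_def \<tau>_def; presburger)+
  moreover have "(\<lambda>i. mix e (mix \<rho> \<rho>') (\<sigma> i)) = mix e \<rho>" for e
    by (rule mix_eqI) (simp_all only: \<sigma>_def mix_even mix_odd)
  moreover have "(\<lambda>i. mix e (mix \<rho> \<rho>') (\<tau> i)) = mix e \<rho>'" for e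
    by (rule mix_eqI) (simp_all only: \<tau>_def mix_even mix_odd)
  ultimately have "P e \<and> Q e \<longleftrightarrow>
      holds mem (mix e (mix \<rho> \<rho>')) (FAnd (rename \<sigma> \<phi>) (rename \<tau> \<psi>))" for e
    by (simp add: P Q holds_rename)
  then show ?thesis unfolding definable_def by blast
qed

lemma definable_ex [dfn]:
  assumes "definable (\<lambda>e. P (\<lambda>i. e (Suc i)) (e 0))"
  shows "definable (\<lambda>e. \<exists>x. P e x)"
proof -
  obtain \<phi> \<rho> where P: "\<And>e. P (\<lambda>i. e (Suc i)) (e 0) \<longleftrightarrow> holds mem (mix e \<rho>) \<phi>"
    using assms unfolding definable_def by blast
  \<comment> \<open>The bound value, on top of the stack, goes to variable 1, the first parameter
    slot; the parameters move up to make room and the rest of the stack moves down one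
    level.\<close>
  define \<sigma> :: "nat \<Rightarrow> nat"
    where "\<sigma> = mix (case_nat (Suc (2 * 0)) (\<lambda>i. 2 * i)) (\<lambda>i. Suc (2 * Suc i))"
  have "inj \<sigma>"
    by (rule inj_mixI; simp only: \<sigma>_def mix_even mix_odd)
       (auto split: nat.splits; presburger)+
  have "P e x \<longleftrightarrow> holds mem ((mix e (case_nat x \<rho>))(1 := x)) (rename \<sigma> \<phi>)" for e x
  proof -
    have "(\<lambda>i. ((mix e (case_nat x \<rho>))(1 := x)) (\<sigma> i)) = mix (case_nat x e) \<rho>"
    proof (rule mix_eqI)
      fix k
      show "((mix e (case_nat x \<rho>))(1 := x)) (\<sigma> (2 * k)) = mix (case_nat x e) \<rho> (2 * k)"
        unfolding \<sigma>_def mix_even by (cases k) auto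
      show "((mix e (case_nat x \<rho>))(1 := x)) (\<sigma> (Suc (2 * k))) = mix (case_nat x e) \<rho> (Suc (2 * k))"
        unfolding \<sigma>_def mix_odd by (simp only: mix_odd fun_upd_apply) auto
    qed
    then show ?thesis
      unfolding holds_rename[OF \<open>inj \<sigma>\<close>] using P[of "case_nat x e"] by (simp only: nat.case)
  qed
  \<comment> \<open>The quantifier overwrites variable 1, so any default value may stand there
    beforehand.\<close>
  moreover have "(mix e (case_nat x \<rho>))(1 := x) = (mix e (case_nat y \<rho>))(1 := x)" for e x y
    by (rule mix_eqI) (auto split: nat.splits)
  ultimately have "(\<exists>x. P e x) \<longleftrightarrow> holds mem (mix e (case_nat undefined \<rho>)) (FEx 1 (rename \<sigma> \<phi>))" for e
    by (metis holds.simps(5))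
  then show ?thesis unfolding definable_def by blast
qed

lemma definable_disj [dfn]: "definable P \<Longrightarrow> definable Q \<Longrightarrow> definable (\<lambda>e. P e \<or> Q e)"
  using definable_neg[OF definable_conj[OF definable_neg definable_neg]] by simp

lemma definable_imp [dfn]: "definable P \<Longrightarrow> definable Q \<Longrightarrow> definable (\<lambda>e. P e \<longrightarrow> Q e)"
  using definable_neg[OF definable_conj[OF _ definable_neg]] by simp

lemma definable_all [dfn]: "definable (\<lambda>e. P (\<lambda>i. e (Suc i)) (e 0)) \<Longrightarrow> definable (\<lambda>e. \<forall>x. P e x)"
  using definable_neg[OF definable_ex[OF definable_neg]] by simp

lemma definable_iff [dfn]:
  assumes "definable P" "definable Q"
  shows "definable (\<lambda>e. P e \<longleftrightarrow> Q e)"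
  unfolding iff_conv_conj_imp by (intro dfn assms)

lemma definable_False [dfn]: "definable (\<lambda>e. False)"
proof -
  have "\<not> holds mem (mix e \<rho>) (FNeg (FEq 0 0))" for e \<rho> by simp
  then show ?thesis unfolding definable_def by blast
qed

section \<open>Definable terms and substitution\<close>

lemma definable_term_var [dfn]: "definable_term (\<lambda>e. e n)"
  and definable_term_const [dfn]: "definable_term (\<lambda>e. c)"
proof -
  have "e 0 = e (Suc n) \<longleftrightarrow> holds mem (mix e \<rho>) (FEq (2 * 0) (2 * Suc n))" for e :: "nat \<Rightarrow> 'a" and \<rho>
    by (simp del: mult_Suc_right mult_0_right)
  then show "definable_term (\<lambda>e. e n)" unfolding definable_def definable_term_def by blast
  have "e 0 = c \<longleftrightarrow> holds mem (mix e (\<lambda>_. c)) (FEq (2 * 0) (Suc (2 * 0)))" for e :: "nat \<Rightarrow> 'a"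
    by (simp del: mult_0_right)
  then show "definable_term (\<lambda>e. c)" unfolding definable_def definable_term_def by blast
qed

text \<open>With \<open>k < m\<close> the value lies below all shifted arguments, so the renaming is
  injective. The general form serves graphs that stand under several nested quantifiers.\<close>

lemma definable_term_graph:
  assumes "definable_term t" "k < m"
  shows "definable (\<lambda>e. e k = t (\<lambda>i. e (i + m)))"
proof -
  have "inj (case_nat k (\<lambda>i. i + m))"
    using assms(2) by (auto simp: inj_def split: nat.splits)
  from definable_rename[OF assms(1)[unfolded definable_term_def] this] show ?thesis by simp
qed

text \<open>A compound term is replaced by a quantified variable constrained by its graph, so
  definability of a relation has to be checked for variables only.\<close>

lemma definable_subst1:
  assumes "\<And>k. definable (\<lambda>e. R (e k))" "definable_term s"
  shows "definable (\<lambda>e. R (s e))"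
proof -
  have "definable (\<lambda>e. \<exists>x. x = s e \<and> R x)"
    by (intro dfn assms) (use definable_term_graph[OF assms(2), of 0 1] in simp)
  then show ?thesis by simp
qed

lemma definable_subst2:
  assumes "\<And>k l. definable (\<lambda>e. R (e k) (e l))" "definable_term s" "definable_term t"
  shows "definable (\<lambda>e. R (s e) (t e))"
proof -
  have "definable (\<lambda>e. \<exists>x y. x = s e \<and> y = t e \<and> R x y)"
    by (intro dfn assms) (use definable_term_graph[OF assms(2), of 1 2]
      definable_term_graph[OF assms(3), of 0 2] in simp_all)
  then show ?thesis by simp
qed

lemma definable_subst3:
  assumes "\<And>k l m. definable (\<lambda>e. R (e k) (e l) (e m))"
    and "definable_term s" "definable_term t" "definable_term u"
  shows "definable (\<lambda>e. R (s e) (t e) (u e))"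
proof -
  have "definable (\<lambda>e. \<exists>x y z. x = s e \<and> y = t e \<and> z = u e \<and> R x y z)"
    by (intro dfn assms) (use definable_term_graph[OF assms(2), of 2 3]
      definable_term_graph[OF assms(3), of 1 3] definable_term_graph[OF assms(4), of 0 3] in
      \<open>simp_all add: numeral_2_eq_2 numeral_3_eq_3\<close>)
  then show ?thesis by simp
qed

lemma definable_eq [dfn]:
  assumes "definable_term s" "definable_term t"
  shows "definable (\<lambda>e. s e = t e)"
proof (rule definable_subst2[OF _ assms])
  fix k l
  have "e k = e l \<longleftrightarrow> holds mem (mix e \<rho>) (FEq (2 * k) (2 * l))" for e :: "nat \<Rightarrow> 'a" and \<rho>
    by simp
  then show "definable (\<lambda>e. e k = e l)" unfolding definable_def by blast
qed

lemma definable_mem [dfn]: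
  assumes "definable_term s" "definable_term t"
  shows "definable (\<lambda>e. s e \<epsilon> t e)"
proof (rule definable_subst2[OF _ assms])
  fix k l
  have "e k \<epsilon> e l \<longleftrightarrow> holds mem (mix e \<rho>) (FMem (2 * k) (2 * l))" for e :: "nat \<Rightarrow> 'a" and \<rho>
    by simp
  then show "definable (\<lambda>e. e k \<epsilon> e l)" unfolding definable_def by blast
qed

lemma definable_term_shift: "definable_term s \<Longrightarrow> definable_term (\<lambda>e. s (\<lambda>i. e (Suc i)))"
  unfolding definable_term_def[of "\<lambda>e. s (\<lambda>i. e (Suc i))"]
  using definable_term_graph[of s 0 2] by simp

lemma definable_term_fun1:
  assumes F: "\<And>k l. definable (\<lambda>e. e k = F (e l))" and s: "definable_term s"
  shows "definable_term (\<lambda>e. F (s e))"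
proof -
  have "definable (\<lambda>e. \<exists>x. x = s (\<lambda>i. e (Suc i)) \<and> e 0 = F x)"
    using definable_conj[OF definable_term_graph[OF s, of 0 2] F[of 1 0]]
    by (intro definable_ex) simp
  then show ?thesis unfolding definable_term_def by simp
qed

lemma definable_term_fun2:
  assumes F: "\<And>k l m. definable (\<lambda>e. e k = F (e l) (e m))"
    and s: "definable_term s" and t: "definable_term t"
  shows "definable_term (\<lambda>e. F (s e) (t e))"
proof -
  have "definable (\<lambda>e. \<exists>x y. x = s (\<lambda>i. e (Suc i)) \<and> y = t (\<lambda>i. e (Suc i)) \<and> e 0 = F x y)"
    using definable_conj[OF definable_term_graph[OF s, of 1 3]
        definable_conj[OF definable_term_graph[OF t, of 0 3] F[of 2 1 0]]]
    by (intro definable_ex) (simp add: numeral_3_eq_3 numeral_2_eq_2)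
  then show ?thesis unfolding definable_term_def by simp
qed

lemma definable_var:
  assumes "definable (\<lambda>e. P (e 0))"
  shows "definable (\<lambda>e. P (e k))"
  using definable_rename[OF assms, of "\<lambda>i. i + k"] by (simp add: inj_def)

lemma elts_iff [simp]: "x \<in> elts A \<longleftrightarrow> x \<epsilon> A"
  by (simp add: elts_def)

section \<open>Separation and replacement for definable predicates\<close>

lemma separationE:
  assumes "definable (\<lambda>e. P (e 0))"
  obtains B where "\<And>x. x \<epsilon> B \<longleftrightarrow> x \<epsilon> A \<and> P x"
proof -
  obtain \<phi> \<rho> where P: "\<And>e. P (e 0) \<longleftrightarrow> holds mem (mix e \<rho>) \<phi>"
    using assms unfolding definable_def by blast
  have "P x \<longleftrightarrow> holds mem ((mix (\<lambda>_. A) \<rho>)(0 := x)) \<phi>" for x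
  proof -
    have "(mix (\<lambda>_. A) \<rho>)(0 := x) = mix ((\<lambda>_. A)(0 := x)) \<rho>"
      by (rule mix_eqI) auto
    then show ?thesis using P[of "(\<lambda>_. A)(0 := x)"] by simp
  qed
  then show ?thesis using separation[of A "mix (\<lambda>_. A) \<rho>" \<phi>] that by metis
qed

lemma replacementE:
  assumes "definable (\<lambda>e. P (e 0) (e 1))"
    and "\<And>x y y'. x \<epsilon> A \<Longrightarrow> P x y \<Longrightarrow> P x y' \<Longrightarrow> y = y'"
  obtains B where "\<And>y. y \<epsilon> B \<longleftrightarrow> (\<exists>x. x \<epsilon> A \<and> P x y)"
proof -
  obtain \<phi> \<rho> where P: "\<And>e. P (e 0) (e 1) \<longleftrightarrow> holds mem (mix e \<rho>) \<phi>"
    using assms(1) unfolding definable_def by blast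
  \<comment> \<open>The second argument sits at variable 2 of \<open>mix\<close>, but the schema
    expects it at variable 1, a parameter slot. \<open>\<sigma>\<close> redirects it and moves the
    parameters up by one.\<close>
  define \<sigma> :: "nat \<Rightarrow> nat"
    where "\<sigma> = mix (\<lambda>i. if i = 1 then Suc (2 * 0) else 2 * i) (\<lambda>i. Suc (2 * Suc i))"
  have "inj \<sigma>"
  proof (rule inj_mixI)
    fix k l
    show "\<sigma> (2 * k) = \<sigma> (2 * l) \<Longrightarrow> k = l"
      unfolding \<sigma>_def mix_even by (simp split: if_splits; presburger)
    show "\<sigma> (Suc (2 * k)) = \<sigma> (Suc (2 * l)) \<Longrightarrow> k = l"
      unfolding \<sigma>_def mix_odd by simp
    show "\<sigma> (2 * k) \<noteq> \<sigma> (Suc (2 * l))"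
      unfolding \<sigma>_def mix_even mix_odd by simp presburger
  qed
  define d where "d = mix (\<lambda>_. A) (case_nat A \<rho>)"
  have "P x y \<longleftrightarrow> holds mem (d(0 := x, 1 := y)) (rename \<sigma> \<phi>)" for x y
  proof -
    have "(\<lambda>i. (d(0 := x, 1 := y)) (\<sigma> i)) = mix (case_nat x (case_nat y (\<lambda>_. A))) \<rho>"
    proof (rule mix_eqI)
      fix k
      show "(d(0 := x, 1 := y)) (\<sigma> (2 * k)) = mix (case_nat x (case_nat y (\<lambda>_. A))) \<rho> (2 * k)"
        unfolding \<sigma>_def mix_even by (auto simp: d_def split: nat.split)
      show "(d(0 := x, 1 := y)) (\<sigma> (Suc (2 * k))) = mix (case_nat x (case_nat y (\<lambda>_. A))) \<rho> (Suc (2 * k))"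
        unfolding \<sigma>_def mix_odd d_def by (simp only: mix_odd fun_upd_apply) auto
    qed
    then show ?thesis
      unfolding holds_rename[OF \<open>inj \<sigma>\<close>] using P[of "case_nat x (case_nat y (\<lambda>_. A))"]
      by (simp only: nat.case One_nat_def)
  qed
  then show ?thesis using replacement[of A d "rename \<sigma> \<phi>"] assms(2) that by metis
qed

lemma definable_ball [dfn]:
  assumes "definable_term t" "definable (\<lambda>e. P (\<lambda>i. e (Suc i)) (e 0))"
  shows "definable (\<lambda>e. \<forall>x\<in>elts (t e). P e x)"
  unfolding Ball_def elts_iff by (intro dfn assms definable_term_shift[OF assms(1)])

lemma definable_bex [dfn]:
  assumes "definable_term t" "definable (\<lambda>e. P (\<lambda>i. e (Suc i)) (e 0))"
  shows "definable (\<lambda>e. \<exists>x\<in>elts (t e). P e x)"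
  unfolding Bex_def elts_iff by (intro dfn assms definable_term_shift[OF assms(1)])

lemma definable_ex1 [dfn]:
  assumes "definable (\<lambda>e. \<exists>x. P e x \<and> (\<forall>y. P e y \<longrightarrow> y = x))"
  shows "definable (\<lambda>e. \<exists>!x. P e x)"
  unfolding Ex1_def by (fact assms)

subsection \<open>Elementary set theory inside the structure\<close>

lemma set_ext: "(\<And>z. z \<epsilon> x \<longleftrightarrow> z \<epsilon> y) \<Longrightarrow> x = y"
  using extensionality by blast

text \<open>Extensionality gives uniqueness, so each later comprehension only has to exhibit some
  set with the right members.\<close>

lemma mem_the_set:
  assumes "\<exists>A. \<forall>x. x \<epsilon> A \<longleftrightarrow> P x"
  shows "z \<epsilon> the_set P \<longleftrightarrow> P z"
proof -
  obtain A where A: "\<And>x. x \<epsilon> A \<longleftrightarrow> P x" using assms by blast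
  have "the_set P = A"
    unfolding the_set_def
    by (rule the_equality) (use A in \<open>auto simp: elts_def intro: set_ext\<close>)
  then show ?thesis using A by simp
qed

definition sep :: "'a \<Rightarrow> ('a \<Rightarrow> bool) \<Rightarrow> 'a" where
  "sep A P = the_set (\<lambda>x. x \<epsilon> A \<and> P x)"

lemma mem_sep:
  assumes "definable (\<lambda>e. P (e 0))"
  shows "x \<epsilon> sep A P \<longleftrightarrow> x \<epsilon> A \<and> P x"
  unfolding sep_def by (rule mem_the_set, rule separationE[OF assms, of A]) blast

lemma mem_zero [simp]: "\<not> x \<epsilon> zero"
proof -
  have "\<exists>A. \<forall>x. x \<epsilon> A \<longleftrightarrow> False"
    using separationE[OF definable_False, of undefined] by (metis (no_types, lifting))
  then show ?thesis using mem_the_set[of "\<lambda>_. False"] unfolding zero_def by simp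
qed

lemma mem_upair [simp]: "z \<epsilon> upair a b \<longleftrightarrow> z = a \<or> z = b"
  unfolding upair_def by (rule mem_the_set[OF pairing])

definition big_union :: "'a \<Rightarrow> 'a" where
  "big_union x = the_set (\<lambda>z. \<exists>y. y \<epsilon> x \<and> z \<epsilon> y)"

lemma mem_big_union [simp]: "z \<epsilon> big_union x \<longleftrightarrow> (\<exists>y. y \<epsilon> x \<and> z \<epsilon> y)"
  unfolding big_union_def by (rule mem_the_set[OF union])

definition union2 :: "'a \<Rightarrow> 'a \<Rightarrow> 'a" where
  "union2 x y = big_union (upair x y)"

lemma mem_union2 [simp]: "z \<epsilon> union2 x y \<longleftrightarrow> z \<epsilon> x \<or> z \<epsilon> y"
  unfolding union2_def by auto

definition pow :: "'a \<Rightarrow> 'a" where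
  "pow x = the_set (\<lambda>y. \<forall>z. z \<epsilon> y \<longrightarrow> z \<epsilon> x)"

lemma mem_pow [simp]: "y \<epsilon> pow x \<longleftrightarrow> elts y \<subseteq> elts x"
  unfolding pow_def subset_iff elts_iff by (rule mem_the_set[OF power_set])

lemma mem_succ [simp]: "z \<epsilon> succ x \<longleftrightarrow> z \<epsilon> x \<or> z = x"
  unfolding succ_def by (rule mem_the_set, rule exI[of _ "union2 x (upair x x)"]) simp

lemma upair_eq_iff: "upair a b = upair c d \<longleftrightarrow> a = c \<and> b = d \<or> a = d \<and> b = c"
proof
  assume *: "upair a b = upair c d"
  have "z = a \<or> z = b \<longleftrightarrow> z = c \<or> z = d" for z using mem_upair[of z] * by metis
  then show "a = c \<and> b = d \<or> a = d \<and> b = c" by metis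
qed (auto intro: set_ext)

lemma opair_inject [simp]: "opair a b = opair c d \<longleftrightarrow> a = c \<and> b = d"
  unfolding opair_def upair_eq_iff by auto

lemma definable_subset [dfn]:
  "definable_term s \<Longrightarrow> definable_term t \<Longrightarrow> definable (\<lambda>e. elts (s e) \<subseteq> elts (t e))"
  by (rule definable_subst2) (unfold subset_iff elts_iff, intro dfn)

text \<open>Rewriting equality as having the same members makes the graph of a set constructor
  first-order; definability of pairs, successors, unions and products rests on this.\<close>

lemma eq_iff_mem: "x = y \<longleftrightarrow> (\<forall>z. z \<epsilon> x \<longleftrightarrow> z \<epsilon> y)"
  using set_ext by blast

lemma definable_upair [dfn]:
  "definable_term s \<Longrightarrow> definable_term t \<Longrightarrow> definable_term (\<lambda>e. upair (s e) (t e))"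
  by (rule definable_term_fun2) (unfold eq_iff_mem[of _ "upair _ _"] mem_upair, intro dfn)

lemma definable_opair [dfn]:
  "definable_term s \<Longrightarrow> definable_term t \<Longrightarrow> definable_term (\<lambda>e. opair (s e) (t e))"
  unfolding opair_def by (intro dfn)

lemma definable_succ [dfn]: "definable_term s \<Longrightarrow> definable_term (\<lambda>e. succ (s e))"
  by (rule definable_term_fun1) (unfold eq_iff_mem[of _ "succ _"] mem_succ, intro dfn)

lemma definable_big_union [dfn]: "definable_term s \<Longrightarrow> definable_term (\<lambda>e. big_union (s e))"
  by (rule definable_term_fun1) (unfold eq_iff_mem[of _ "big_union _"] mem_big_union, intro dfn)

lemma definable_union2 [dfn]:
  "definable_term s \<Longrightarrow> definable_term t \<Longrightarrow> definable_term (\<lambda>e. union2 (s e) (t e))"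
  unfolding union2_def by (intro dfn)

definition prod :: "'a \<Rightarrow> 'a \<Rightarrow> 'a" where
  "prod A B = sep (pow (pow (union2 A B))) (\<lambda>z. \<exists>x y. x \<epsilon> A \<and> y \<epsilon> B \<and> z = opair x y)"

text \<open>Kuratowski pairs over \<open>A\<close> and \<open>B\<close> already lie in the double
  power set of the union, so the bound used for separation drops out.\<close>

lemma mem_prod [simp]: "z \<epsilon> prod A B \<longleftrightarrow> (\<exists>x y. x \<epsilon> A \<and> y \<epsilon> B \<and> z = opair x y)"
proof -
  have "z \<epsilon> prod A B \<longleftrightarrow> z \<epsilon> pow (pow (union2 A B)) \<and> (\<exists>x y. x \<epsilon> A \<and> y \<epsilon> B \<and> z = opair x y)"
    unfolding prod_def by (rule mem_sep, intro dfn)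
  then show ?thesis by (auto simp: opair_def)
qed

lemma definable_prod [dfn]:
  "definable_term s \<Longrightarrow> definable_term t \<Longrightarrow> definable_term (\<lambda>e. prod (s e) (t e))"
  by (rule definable_term_fun2) (unfold eq_iff_mem[of _ "prod _ _"] mem_prod, intro dfn)

text \<open>Foundation is applied to the subset of \<open>A\<close> separated by
  \<open>P\<close>.\<close>

lemma foundationE:
  assumes "definable (\<lambda>e. P (e 0))" "x \<epsilon> A" "P x"
  obtains y where "y \<epsilon> A" "P y" "\<And>z. z \<epsilon> y \<Longrightarrow> z \<epsilon> A \<Longrightarrow> \<not> P z"
proof -
  have "\<exists>z. z \<epsilon> sep A P" using assms mem_sep by blast
  from foundation[OF this] show ?thesis using that by (auto simp: mem_sep[OF assms(1)])
qed

lemma mem_irrefl [simp]: "\<not> x \<epsilon> x"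
  using foundation[of "upair x x"] by auto

lemma mem_asym: "x \<epsilon> y \<Longrightarrow> \<not> y \<epsilon> x"
  using foundation[of "upair x y"] by auto

section \<open>Natural numbers of the structure\<close>

lemma succ_inject [simp]: "succ x = succ y \<longleftrightarrow> x = y"
  by (metis mem_succ mem_asym)

lemma succ_neq_zero [simp]: "succ x \<noteq> zero" "zero \<noteq> succ x"
  by (metis mem_succ mem_zero)+

lemma omega_ex: "\<exists>w. zero \<epsilon> w \<and> (\<forall>x\<in>elts w. succ x \<epsilon> w)"
proof -
  obtain w where w: "\<exists>x. x \<epsilon> w \<and> (\<forall>z. \<not> z \<epsilon> x)"
    "\<And>x. x \<epsilon> w \<Longrightarrow> \<exists>y. y \<epsilon> w \<and> (\<forall>z. z \<epsilon> y \<longleftrightarrow> z \<epsilon> x \<or> z = x)"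
    using infinity by blast
  have "zero \<epsilon> w" using w(1) by (metis mem_zero set_ext)
  moreover have "succ x \<epsilon> w" if "x \<epsilon> w" for x
    using w(2)[OF that] by (metis mem_succ set_ext)
  ultimately show ?thesis by auto
qed

text \<open>The intersection of all inductive sets is a set because it can be separated from any one
  of them.\<close>

lemma mem_omega: "n \<epsilon> omega \<longleftrightarrow> (\<forall>w. zero \<epsilon> w \<and> (\<forall>x\<in>elts w. succ x \<epsilon> w) \<longrightarrow> n \<epsilon> w)"
proof -
  let ?P = "\<lambda>n. \<forall>w. zero \<epsilon> w \<and> (\<forall>x\<in>elts w. succ x \<epsilon> w) \<longrightarrow> n \<epsilon> w"
  obtain w where w: "zero \<epsilon> w \<and> (\<forall>x\<in>elts w. succ x \<epsilon> w)" using omega_ex by blast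
  have "definable (\<lambda>e. ?P (e 0))" by (intro dfn)
  from separationE[OF this, of w] obtain B where "\<And>x. x \<epsilon> B \<longleftrightarrow> x \<epsilon> w \<and> ?P x" by blast
  with w have "\<exists>B. \<forall>x. x \<epsilon> B \<longleftrightarrow> ?P x" by blast
  then show ?thesis unfolding omega_def by (rule mem_the_set)
qed

lemma zero_omega [simp]: "zero \<epsilon> omega"
  and succ_omega [simp]: "n \<epsilon> omega \<Longrightarrow> succ n \<epsilon> omega"
  by (auto simp: mem_omega)

text \<open>The subset of \<open>omega\<close> separated by \<open>P\<close> is inductive. Since
  \<open>omega\<close> may be nonstandard, induction is available for definable properties
  only.\<close>

lemma omega_induct [consumes 2, case_names zero succ]:
  assumes "definable (\<lambda>e. P (e 0))" "n \<epsilon> omega"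
    and "P zero" "\<And>n. n \<epsilon> omega \<Longrightarrow> P n \<Longrightarrow> P (succ n)"
  shows "P n"
proof -
  have "zero \<epsilon> sep omega P \<and> (\<forall>x\<in>elts (sep omega P). succ x \<epsilon> sep omega P)"
    using assms by (simp add: mem_sep)
  then have "n \<epsilon> sep omega P" using assms(2) mem_omega by blast
  then show ?thesis by (simp add: mem_sep[OF assms(1)])
qed

subsection \<open>Functions\<close>

lemma is_fun_app:
  assumes "is_fun f A B" "x \<epsilon> A"
  shows "opair x (app f x) \<epsilon> f" "app f x \<epsilon> B"
proof -
  have "\<exists>!y. opair x y \<epsilon> f" using assms unfolding is_fun_def by simp
  then show *: "opair x (app f x) \<epsilon> f" unfolding app_def by (rule theI')
  then show "app f x \<epsilon> B" using assms(1) unfolding is_fun_def elts_iff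
    by (metis elts_iff opair_inject)
qed

text \<open>Trades the description \<open>app\<close> for membership of a pair, the first-order form
  in which definability goals about functions are stated.\<close>

lemma is_fun_opair_iff:
  assumes "is_fun f A B"
  shows "opair x y \<epsilon> f \<longleftrightarrow> x \<epsilon> A \<and> y = app f x"
proof
  assume *: "opair x y \<epsilon> f"
  then have "x \<epsilon> A" using assms unfolding is_fun_def by (metis elts_iff opair_inject)
  moreover have "\<exists>!y. opair x y \<epsilon> f" using assms \<open>x \<epsilon> A\<close> unfolding is_fun_def by simp
  ultimately show "x \<epsilon> A \<and> y = app f x" using * is_fun_app(1)[OF assms \<open>x \<epsilon> A\<close>] by blast
qed (use is_fun_app[OF assms] in blast)

lemma is_fun_elem:
  assumes "is_fun f A B" "z \<epsilon> f"
  obtains x where "x \<epsilon> A" "z = opair x (app f x)"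
  using assms is_fun_opair_iff[OF assms(1)] unfolding is_fun_def elts_iff by (metis elts_iff)

lemma fun_ext:
  assumes "is_fun f A B" "is_fun g A C" "\<And>x. x \<epsilon> A \<Longrightarrow> app f x = app g x"
  shows "f = g"
proof (rule set_ext)
  fix z show "z \<epsilon> f \<longleftrightarrow> z \<epsilon> g"
    by (metis assms is_fun_app(1) is_fun_elem)
qed

lemma definable_is_fun [dfn]:
  "definable_term s \<Longrightarrow> definable_term t \<Longrightarrow> definable_term u \<Longrightarrow>
    definable (\<lambda>e. is_fun (s e) (t e) (u e))"
  by (rule definable_subst3) (unfold is_fun_def, intro dfn)

text \<open>\<open>F\<close> may be any HOL function; definability is asked of \<open>R\<close>,
  which has to describe the graph of \<open>F\<close> on \<open>A\<close> times
  \<open>B\<close>.\<close>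

lemma functionE:
  assumes R: "\<And>k l. definable (\<lambda>e. R (e k) (e l))"
    and F: "\<And>x. x \<epsilon> A \<Longrightarrow> F x \<epsilon> B" "\<And>x y. x \<epsilon> A \<Longrightarrow> y \<epsilon> B \<Longrightarrow> R x y \<longleftrightarrow> y = F x"
  obtains f where "is_fun f A B" "\<And>x. x \<epsilon> A \<Longrightarrow> app f x = F x"
proof -
  define f where "f = sep (prod A B) (\<lambda>z. \<exists>x y. z = opair x y \<and> R x y)"
  have "definable (\<lambda>e. \<exists>x y. e 0 = opair x y \<and> R x y)" by (intro dfn R)
  then have mem: "z \<epsilon> f \<longleftrightarrow> (\<exists>x. x \<epsilon> A \<and> z = opair x (F x))" for z
    unfolding f_def using mem_sep[of "\<lambda>z. \<exists>x y. z = opair x y \<and> R x y"] F by auto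
  then have "is_fun f A B" unfolding is_fun_def using F(1) by auto
  moreover have "app f x = F x" if "x \<epsilon> A" for x
    using mem[of "opair x (F x)"] that is_fun_opair_iff[OF \<open>is_fun f A B\<close>, of x "F x"] by auto
  ultimately show ?thesis using that by blast
qed

lemma is_injection_iff:
  "is_injection f A B \<longleftrightarrow>
    is_fun f A B \<and> (\<forall>x x' y. opair x y \<epsilon> f \<and> opair x' y \<epsilon> f \<longrightarrow> x = x')"
  unfolding is_injection_def inj_on_def
  by (auto simp: is_fun_opair_iff)

lemma definable_is_injection [dfn]:
  "definable_term s \<Longrightarrow> definable_term t \<Longrightarrow> definable_term u \<Longrightarrow>
    definable (\<lambda>e. is_injection (s e) (t e) (u e))"
  by (rule definable_subst3) (unfold is_injection_iff, intro dfn)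

definition funs :: "'a \<Rightarrow> 'a \<Rightarrow> 'a" where
  "funs A B = sep (pow (prod A B)) (\<lambda>f. is_fun f A B)"

lemma mem_funs [simp]: "f \<epsilon> funs A B \<longleftrightarrow> is_fun f A B"
proof -
  have "f \<epsilon> funs A B \<longleftrightarrow> f \<epsilon> pow (prod A B) \<and> is_fun f A B"
    unfolding funs_def by (rule mem_sep, intro dfn)
  moreover have "f \<epsilon> pow (prod A B)" if "is_fun f A B"
    using that unfolding is_fun_def by (force simp: subset_iff)
  ultimately show ?thesis by blast
qed

subsection \<open>Inductively generated classes and iteration\<close>

text \<open>
  A class generated by axioms \<open>Ax\<close> and rules \<open>B\<close> with two premises is first-order definable: an
  object is generated iff it lies in a set all of whose elements are justified inside that set.
\<close>

definition justified :: "('a \<Rightarrow> bool) \<Rightarrow> ('a \<Rightarrow> 'a \<Rightarrow> 'a \<Rightarrow> bool) \<Rightarrow> 'a \<Rightarrow> bool" where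
  "justified Ax B g \<longleftrightarrow> (\<forall>w. w \<epsilon> g \<longrightarrow> Ax w \<or> (\<exists>u v. u \<epsilon> g \<and> v \<epsilon> g \<and> B u v w))"

definition generated :: "('a \<Rightarrow> bool) \<Rightarrow> ('a \<Rightarrow> 'a \<Rightarrow> 'a \<Rightarrow> bool) \<Rightarrow> 'a \<Rightarrow> bool" where
  "generated Ax B z \<longleftrightarrow> (\<exists>g. justified Ax B g \<and> z \<epsilon> g)"

lemma generated_axiom: "Ax z \<Longrightarrow> generated Ax B z"
  unfolding generated_def justified_def by (rule exI[of _ "upair z z"]) auto

text \<open>Justified sets are closed under union, and adding a conclusion whose premises are
  present keeps a set justified.\<close>

lemma generated_rule:
  assumes "generated Ax B u" "generated Ax B v" "B u v z"
  shows "generated Ax B z"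
proof -
  obtain g h where "justified Ax B g" "u \<epsilon> g" "justified Ax B h" "v \<epsilon> h"
    using assms unfolding generated_def by blast
  then have "justified Ax B (union2 (union2 g h) (upair z z))"
    using assms(3) unfolding justified_def mem_union2 mem_upair by blast
  then show ?thesis unfolding generated_def by (metis mem_union2 mem_upair)
qed

text \<open>Justification inside a set could be circular, so only inversion is available in general.
  The uses below regain uniqueness by induction over \<open>omega\<close> or over formulas.\<close>

lemma generated_cases:
  assumes "generated Ax B z"
  obtains "Ax z" | u v where "generated Ax B u" "generated Ax B v" "B u v z"
  using assms unfolding generated_def justified_def by blast

lemma definable_generated:
  assumes "\<And>k. definable (\<lambda>e. Ax (e k))" "\<And>k l m. definable (\<lambda>e. B (e k) (e l) (e m))"
    and "definable_term s"
  shows "definable (\<lambda>e. generated Ax B (s e))"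
  by (rule definable_subst1[OF _ assms(3)])
    (unfold generated_def justified_def, intro dfn assms(1,2))

text \<open>\<open>reach n Y\<close> says that \<open>Y\<close> is the \<open>n\<close>-th iterate
  of \<open>X\<close>. Induction over \<open>omega\<close> makes it functional in \<open>n\<close>,
  and replacement then gathers the iterates into \<open>W\<close>; the last conclusion is induction
  along them.\<close>

lemma iterationE:
  assumes H: "\<And>k l. definable (\<lambda>e. e k = H (e l))"
  obtains W where "X \<epsilon> W" "\<And>Y. Y \<epsilon> W \<Longrightarrow> H Y \<epsilon> W"
    and "\<And>P Y. definable (\<lambda>e. P (e 0)) \<Longrightarrow> Y \<epsilon> W \<Longrightarrow> P X \<Longrightarrow>
      (\<And>Y. Y \<epsilon> W \<Longrightarrow> P Y \<Longrightarrow> P (H Y)) \<Longrightarrow> P Y"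
proof -
  have H': "definable_term s \<Longrightarrow> definable_term (\<lambda>e. H (s e))" for s
    by (rule definable_term_fun1[OF H])
  define Ax where "Ax = (\<lambda>z. z = opair zero X)"
  \<comment> \<open>Iteration has one premise, so the two-premise rule is given the same object
    twice.\<close>
  define B where "B = (\<lambda>u v z. \<exists>n Y. u = opair n Y \<and> v = u \<and> z = opair (succ n) (H Y))"
  define reach where "reach n Y = generated Ax B (opair n Y)" for n Y
  have reach_dfn: "definable_term s \<Longrightarrow> definable_term t \<Longrightarrow> definable (\<lambda>e. reach (s e) (t e))" for s t
    unfolding reach_def Ax_def B_def by (rule definable_generated; intro dfn H')
  have reach_zero: "reach zero Y \<longleftrightarrow> Y = X" for Y
  proof
    assume "reach zero Y"
    then show "Y = X" unfolding reach_def by (cases rule: generated_cases) (auto simp: Ax_def B_def)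
  next
    show "Y = X \<Longrightarrow> reach zero Y" unfolding reach_def by (rule generated_axiom) (simp add: Ax_def)
  qed
  have reach_succ: "reach (succ n) Z \<longleftrightarrow> (\<exists>Y. reach n Y \<and> Z = H Y)" for n Z
  proof
    assume "reach (succ n) Z"
    then show "\<exists>Y. reach n Y \<and> Z = H Y"
      unfolding reach_def by (cases rule: generated_cases) (auto simp: Ax_def B_def)
  next
    assume "\<exists>Y. reach n Y \<and> Z = H Y"
    then obtain Y where "generated Ax B (opair n Y)" "Z = H Y" unfolding reach_def by blast
    then show "reach (succ n) Z"
      unfolding reach_def by (rule_tac generated_rule[of Ax B "opair n Y" "opair n Y"]) (auto simp: B_def)
  qed
  have ex1: "\<exists>Y. \<forall>Z. reach n Z \<longleftrightarrow> Z = Y" if "n \<epsilon> omega" for n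
  proof -
    have "definable (\<lambda>e. \<exists>Y. \<forall>Z. reach (e 0) Z \<longleftrightarrow> Z = Y)" by (intro dfn reach_dfn)
    from this that show ?thesis
    proof (induction rule: omega_induct)
      case zero
      show ?case using reach_zero by blast
    next
      case (succ n)
      then obtain Y where "\<And>Z. reach n Z \<longleftrightarrow> Z = Y" by blast
      then have "\<forall>Z. reach (succ n) Z \<longleftrightarrow> Z = H Y" using reach_succ by simp
      then show ?case by blast
    qed
  qed
  have dfn_reach: "definable (\<lambda>e. reach (e 0) (e 1))" by (intro dfn reach_dfn)
  have functional: "y = y'" if "n \<epsilon> omega" "reach n y" "reach n y'" for n y y'
    using ex1[OF that(1)] that by metis
  obtain W where W: "\<And>Y. Y \<epsilon> W \<longleftrightarrow> (\<exists>n. n \<epsilon> omega \<and> reach n Y)"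
    by (rule replacementE[of reach omega, OF dfn_reach functional]) (assumption | blast)+
  show ?thesis
  proof (rule that)
    show "X \<epsilon> W" using W reach_zero zero_omega by blast
    show "H Y \<epsilon> W" if "Y \<epsilon> W" for Y using that W reach_succ succ_omega by blast
    show "P Y" if P: "definable (\<lambda>e. P (e 0))" and "Y \<epsilon> W" and "P X"
      and step: "\<And>Y. Y \<epsilon> W \<Longrightarrow> P Y \<Longrightarrow> P (H Y)" for P Y
    proof -
      obtain n where "n \<epsilon> omega" "reach n Y" using W \<open>Y \<epsilon> W\<close> by blast
      have "definable (\<lambda>e. \<forall>Y. reach (e 0) Y \<longrightarrow> P Y)"
        by (intro dfn reach_dfn definable_var[OF P])
      from this \<open>n \<epsilon> omega\<close> have "\<forall>Y. reach n Y \<longrightarrow> P Y"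
      proof (induction rule: omega_induct)
        case zero
        then show ?case using \<open>P X\<close> reach_zero by simp
      next
        case (succ n)
        show ?case
        proof (intro allI impI)
          fix Z assume "reach (succ n) Z"
          then obtain Y where "reach n Y" "Z = H Y" using reach_succ by blast
          then show "P Z" using succ step[of Y] W[of Y] by blast
        qed
      qed
      then show ?thesis using \<open>reach n Y\<close> by blast
    qed
  qed
qed

section \<open>Transitive supersets, membership induction and closure under pairing\<close>

text \<open>The usual transitive closure: the union of all sets reached from \<open>X\<close> by
  iterating \<open>big_union\<close>.\<close>

lemma transitive_supersetE:
  obtains T where "transitive T" "elts X \<subseteq> elts T"
proof -
  obtain W where W: "X \<epsilon> W" "\<And>Y. Y \<epsilon> W \<Longrightarrow> big_union Y \<epsilon> W"
  proof (rule iterationE[of big_union X])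
    show "definable (\<lambda>e. e k = big_union (e l))" for k l by (intro dfn)
  qed blast
  have "transitive (big_union W)"
    unfolding transitive_def using W(2) by (fastforce simp: subset_iff)
  moreover have "elts X \<subseteq> elts (big_union W)" using W(1) by auto
  ultimately show ?thesis using that by blast
qed

text \<open>Foundation speaks about sets, so a minimal counterexample is sought inside a transitive
  set containing \<open>x\<close>; its members stay in that set.\<close>

lemma mem_induct [consumes 1, case_names step]:
  assumes P: "definable (\<lambda>e. P (e 0))" and step: "\<And>x. (\<And>y. y \<epsilon> x \<Longrightarrow> P y) \<Longrightarrow> P x"
  shows "P x"
proof (rule ccontr)
  assume "\<not> P x"
  obtain T where T: "transitive T" "elts (upair x x) \<subseteq> elts T" by (rule transitive_supersetE)
  have "definable (\<lambda>e. \<not> P (e 0))" by (intro dfn P)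
  then obtain y where "y \<epsilon> T" "\<not> P y" "\<And>z. z \<epsilon> y \<Longrightarrow> z \<epsilon> T \<Longrightarrow> P z"
    by (rule foundationE[of "\<lambda>y. \<not> P y" x T]) (use T(2) \<open>\<not> P x\<close> in \<open>auto simp: subset_iff\<close>)
  then show False using T(1) step unfolding transitive_def by (auto simp: subset_iff)
qed

text \<open>The stages obtained by repeatedly adding all pairs form a chain, so two members of the
  union lie in a common stage and the next stage contains their pair.\<close>

lemma opair_closureE:
  obtains U where "elts X \<subseteq> elts U" "\<And>x y. x \<epsilon> U \<Longrightarrow> y \<epsilon> U \<Longrightarrow> opair x y \<epsilon> U"
proof -
  define H where "H Y = union2 Y (prod Y Y)" for Y
  have "definable (\<lambda>e. e k = H (e l))" for k l unfolding H_def by (intro dfn)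
  from iterationE[OF this, of X] obtain W where W: "X \<epsilon> W" "\<And>Y. Y \<epsilon> W \<Longrightarrow> H Y \<epsilon> W"
    and ind: "\<And>P Y. definable (\<lambda>e. P (e 0)) \<Longrightarrow> Y \<epsilon> W \<Longrightarrow> P X \<Longrightarrow>
      (\<And>Y. Y \<epsilon> W \<Longrightarrow> P Y \<Longrightarrow> P (H Y)) \<Longrightarrow> P Y" by blast
  have incr: "elts Y \<subseteq> elts (H Y)" and mono: "elts Y \<subseteq> elts Z \<Longrightarrow> elts (H Y) \<subseteq> elts (H Z)" for Y Z
    by (auto simp: H_def subset_iff)
  have base: "elts X \<subseteq> elts Z" if "Z \<epsilon> W" for Z
    by (rule ind[where P = "\<lambda>Z. elts X \<subseteq> elts Z", OF _ that])
      (intro dfn, use incr in \<open>auto intro: subset_trans\<close>)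
  \<comment> \<open>Double induction on stages. In the inner step \<open>Y\<close> is comparable
    with \<open>Z\<close> by the outer hypothesis, and monotonicity of \<open>H\<close> transfers
    this to \<open>H Y\<close> and \<open>H Z\<close>.\<close>
  have comparable: "\<forall>Z. Z \<epsilon> W \<longrightarrow> elts Y \<subseteq> elts Z \<or> elts Z \<subseteq> elts Y" if "Y \<epsilon> W" for Y
  proof (rule ind[where P = "\<lambda>Y. \<forall>Z. Z \<epsilon> W \<longrightarrow> elts Y \<subseteq> elts Z \<or> elts Z \<subseteq> elts Y", OF _ that])
    show "definable (\<lambda>e. \<forall>Z. Z \<epsilon> W \<longrightarrow> elts (e 0) \<subseteq> elts Z \<or> elts Z \<subseteq> elts (e 0))"
      by (intro dfn)
    show "\<forall>Z. Z \<epsilon> W \<longrightarrow> elts X \<subseteq> elts Z \<or> elts Z \<subseteq> elts X" using base by blast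
    fix Y assume "Y \<epsilon> W" and Y: "\<forall>Z. Z \<epsilon> W \<longrightarrow> elts Y \<subseteq> elts Z \<or> elts Z \<subseteq> elts Y"
    show "\<forall>Z. Z \<epsilon> W \<longrightarrow> elts (H Y) \<subseteq> elts Z \<or> elts Z \<subseteq> elts (H Y)"
    proof (intro allI impI)
      fix Z assume "Z \<epsilon> W"
      show "elts (H Y) \<subseteq> elts Z \<or> elts Z \<subseteq> elts (H Y)"
      proof (rule ind[where P = "\<lambda>Z. elts (H Y) \<subseteq> elts Z \<or> elts Z \<subseteq> elts (H Y)", OF _ \<open>Z \<epsilon> W\<close>])
        show "definable (\<lambda>e. elts (H Y) \<subseteq> elts (e 0) \<or> elts (e 0) \<subseteq> elts (H Y))" by (intro dfn)
        show "elts (H Y) \<subseteq> elts X \<or> elts X \<subseteq> elts (H Y)" using base W(2) \<open>Y \<epsilon> W\<close> by simp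
        show "elts (H Y) \<subseteq> elts (H Z) \<or> elts (H Z) \<subseteq> elts (H Y)" if "Z \<epsilon> W" for Z
          using Y that mono by metis
      qed
    qed
  qed
  have "opair x y \<epsilon> big_union W" if xy: "x \<epsilon> big_union W" "y \<epsilon> big_union W" for x y
  proof -
    obtain Y Z where "Y \<epsilon> W" "x \<in> elts Y" "Z \<epsilon> W" "y \<in> elts Z"
      using xy unfolding mem_big_union elts_iff by blast
    then have "\<exists>Y. Y \<epsilon> W \<and> x \<in> elts Y \<and> y \<in> elts Y" using comparable by blast
    then obtain Y where "Y \<epsilon> W" "x \<epsilon> Y" "y \<epsilon> Y" by auto
    then have "H Y \<epsilon> W" "opair x y \<epsilon> H Y" using W(2) by (auto simp: H_def)
    then show ?thesis by auto
  qed
  moreover have "elts X \<subseteq> elts (big_union W)" using W(1) by auto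
  ultimately show ?thesis using that by blast
qed

subsection \<open>Formula codes and satisfaction\<close>

lemmas code_defs = code_mem_def code_eq_def code_neg_def code_and_def code_ex_def

lemma definable_code_neg [dfn]: "definable_term s \<Longrightarrow> definable_term (\<lambda>e. code_neg (s e))"
  unfolding code_neg_def by (intro dfn)

lemma definable_code [dfn]:
  assumes "definable_term s" "definable_term t"
  shows "definable_term (\<lambda>e. code_mem (s e) (t e))" "definable_term (\<lambda>e. code_eq (s e) (t e))"
    "definable_term (\<lambda>e. code_and (s e) (t e))" "definable_term (\<lambda>e. code_ex (s e) (t e))"
  unfolding code_defs by (intro dfn assms)+

lemma code_inject [simp]:
  "code_mem m n = code_mem m' n' \<longleftrightarrow> m = m' \<and> n = n'"
  "code_eq m n = code_eq m' n' \<longleftrightarrow> m = m' \<and> n = n'"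
  "code_neg p = code_neg p' \<longleftrightarrow> p = p'"
  "code_and p q = code_and p' q' \<longleftrightarrow> p = p' \<and> q = q'"
  "code_ex n p = code_ex n' p' \<longleftrightarrow> n = n' \<and> p = p'"
  by (simp_all add: code_defs)

lemma code_distinct [simp]:
  "code_mem m n \<noteq> code_eq m' n'" "code_eq m' n' \<noteq> code_mem m n"
  "code_mem m n \<noteq> code_neg p" "code_neg p \<noteq> code_mem m n"
  "code_mem m n \<noteq> code_and p q" "code_and p q \<noteq> code_mem m n"
  "code_mem m n \<noteq> code_ex k p" "code_ex k p \<noteq> code_mem m n"
  "code_eq m n \<noteq> code_neg p" "code_neg p \<noteq> code_eq m n"
  "code_eq m n \<noteq> code_and p q" "code_and p q \<noteq> code_eq m n"
  "code_eq m n \<noteq> code_ex k p" "code_ex k p \<noteq> code_eq m n"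
  "code_neg r \<noteq> code_and p q" "code_and p q \<noteq> code_neg r"
  "code_neg r \<noteq> code_ex k p" "code_ex k p \<noteq> code_neg r"
  "code_and r q \<noteq> code_ex k p" "code_ex k p \<noteq> code_and r q"
  by (simp_all add: code_defs)

lemma definable_is_formula [dfn]: "definable_term s \<Longrightarrow> definable (\<lambda>e. is_formula (s e))"
  by (rule definable_subst1) (unfold is_formula_def formula_closed_def, intro dfn)

lemma formula_closedI:
  assumes "\<And>m n. m \<epsilon> omega \<Longrightarrow> n \<epsilon> omega \<Longrightarrow> code_mem m n \<epsilon> X"
    and "\<And>m n. m \<epsilon> omega \<Longrightarrow> n \<epsilon> omega \<Longrightarrow> code_eq m n \<epsilon> X"
    and "\<And>p. p \<epsilon> X \<Longrightarrow> code_neg p \<epsilon> X"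
    and "\<And>p q. p \<epsilon> X \<Longrightarrow> q \<epsilon> X \<Longrightarrow> code_and p q \<epsilon> X"
    and "\<And>n p. n \<epsilon> omega \<Longrightarrow> p \<epsilon> X \<Longrightarrow> code_ex n p \<epsilon> X"
  shows "formula_closed X"
  using assms by (auto simp: formula_closed_def)

lemma is_formula_code [simp]:
  "m \<epsilon> omega \<Longrightarrow> n \<epsilon> omega \<Longrightarrow> is_formula (code_mem m n)"
  "m \<epsilon> omega \<Longrightarrow> n \<epsilon> omega \<Longrightarrow> is_formula (code_eq m n)"
  "is_formula p \<Longrightarrow> is_formula (code_neg p)"
  "is_formula p \<Longrightarrow> is_formula q \<Longrightarrow> is_formula (code_and p q)"
  "n \<epsilon> omega \<Longrightarrow> is_formula p \<Longrightarrow> is_formula (code_ex n p)"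
  by (auto simp: is_formula_def formula_closed_def)

text \<open>Codes are nested pairs of numerals, so closure under pairing above \<open>omega\<close>
  already gives closure under every formula constructor.\<close>

lemma formula_closed_opair_closed:
  assumes "elts omega \<subseteq> elts U" and U: "\<And>x y. x \<epsilon> U \<Longrightarrow> y \<epsilon> U \<Longrightarrow> opair x y \<epsilon> U"
  shows "formula_closed U"
proof -
  have "n \<epsilon> U" if "n \<epsilon> omega" for n using assms(1) that by (auto simp: subset_iff)
  then show ?thesis by (intro formula_closedI) (auto simp: code_defs intro!: U)
qed

definition fmls :: 'a where
  "fmls = the_set is_formula"

text \<open>\<open>is_formula\<close> quantifies over all closed sets; one such set bounds the class
  and separation makes it a set.\<close>

lemma mem_fmls [simp]: "p \<epsilon> fmls \<longleftrightarrow> is_formula p"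
proof -
  obtain U where U: "elts omega \<subseteq> elts U" "\<And>x y. x \<epsilon> U \<Longrightarrow> y \<epsilon> U \<Longrightarrow> opair x y \<epsilon> U"
    by (rule opair_closureE) blast
  then have "is_formula x \<Longrightarrow> x \<epsilon> U" for x
    using formula_closed_opair_closed unfolding is_formula_def by blast
  moreover have "definable (\<lambda>e. is_formula (e 0))" by (intro dfn)
  then have "\<And>x. x \<epsilon> sep U is_formula \<longleftrightarrow> x \<epsilon> U \<and> is_formula x" by (rule mem_sep)
  ultimately have "\<exists>A. \<forall>x. x \<epsilon> A \<longleftrightarrow> is_formula x" by blast
  then show ?thesis unfolding fmls_def by (rule mem_the_set)
qed

lemma formula_induct [consumes 2, case_names mem eq neg conj ex]:
  assumes P: "definable (\<lambda>e. P (e 0))" and "is_formula p"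
    and "\<And>m n. m \<epsilon> omega \<Longrightarrow> n \<epsilon> omega \<Longrightarrow> P (code_mem m n)"
    and "\<And>m n. m \<epsilon> omega \<Longrightarrow> n \<epsilon> omega \<Longrightarrow> P (code_eq m n)"
    and "\<And>p. is_formula p \<Longrightarrow> P p \<Longrightarrow> P (code_neg p)"
    and "\<And>p q. is_formula p \<Longrightarrow> P p \<Longrightarrow> is_formula q \<Longrightarrow> P q \<Longrightarrow> P (code_and p q)"
    and "\<And>n p. n \<epsilon> omega \<Longrightarrow> is_formula p \<Longrightarrow> P p \<Longrightarrow> P (code_ex n p)"
  shows "P p"
proof -
  have "formula_closed (sep fmls P)"
    using assms by (intro formula_closedI) (auto simp: mem_sep[OF P])
  then have "p \<epsilon> sep fmls P" using \<open>is_formula p\<close> unfolding is_formula_def by blast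
  then show ?thesis by (simp add: mem_sep[OF P])
qed

section \<open>Truth sets and the satisfaction relation\<close>

text \<open>Stated by membership of pairs instead of \<open>app\<close>, so that it is visibly
  first-order.\<close>

definition agree_off :: "'a \<Rightarrow> 'a \<Rightarrow> 'a \<Rightarrow> bool" where
  "agree_off n a b \<longleftrightarrow>
    (\<forall>k\<in>elts omega. k \<noteq> n \<longrightarrow> (\<forall>x. opair k x \<epsilon> b \<longleftrightarrow> opair k x \<epsilon> a))"

lemma agree_off_iff:
  assumes "is_fun a omega M" "is_fun b omega M"
  shows "agree_off n a b \<longleftrightarrow> (\<forall>k\<in>elts omega. k \<noteq> n \<longrightarrow> app b k = app a k)"
  unfolding agree_off_def using assms by (auto simp: is_fun_opair_iff)

lemma definable_agree_off [dfn]: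
  "definable_term s \<Longrightarrow> definable_term t \<Longrightarrow> definable_term u \<Longrightarrow>
    definable (\<lambda>e. agree_off (s e) (t e) (u e))"
  by (rule definable_subst3) (unfold agree_off_def, intro dfn)

text \<open>\<open>truth_set M p X\<close> says that \<open>X\<close> is the set of assignments making \<open>p\<close> true in \<open>M\<close>.\<close>

definition truth_axiom :: "'a \<Rightarrow> 'a \<Rightarrow> bool" where
  "truth_axiom M z \<longleftrightarrow> (\<exists>m n X. m \<epsilon> omega \<and> n \<epsilon> omega \<and>
    (z = opair (code_mem m n) X \<and> (\<forall>a. a \<epsilon> X \<longleftrightarrow> is_fun a omega M \<and>
        (\<exists>x. opair m x \<epsilon> a \<and> (\<exists>y. opair n y \<epsilon> a \<and> x \<epsilon> y))) \<or>
     z = opair (code_eq m n) X \<and> (\<forall>a. a \<epsilon> X \<longleftrightarrow> is_fun a omega M \<and>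
        (\<exists>x. opair m x \<epsilon> a \<and> opair n x \<epsilon> a))))"

definition truth_rule :: "'a \<Rightarrow> 'a \<Rightarrow> 'a \<Rightarrow> 'a \<Rightarrow> bool" where
  "truth_rule M u v z \<longleftrightarrow> (\<exists>p q X Y Z. u = opair p X \<and> v = opair q Y \<and>
    (z = opair (code_neg p) Z \<and> (\<forall>a. a \<epsilon> Z \<longleftrightarrow> is_fun a omega M \<and> \<not> a \<epsilon> X) \<or>
     z = opair (code_and p q) Z \<and> (\<forall>a. a \<epsilon> Z \<longleftrightarrow> a \<epsilon> X \<and> a \<epsilon> Y) \<or>
     (\<exists>n. n \<epsilon> omega \<and> z = opair (code_ex n p) Z \<and>
        (\<forall>a. a \<epsilon> Z \<longleftrightarrow> is_fun a omega M \<and> (\<exists>b. b \<epsilon> X \<and> is_fun b omega M \<and> agree_off n a b)))))"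

definition truth_set :: "'a \<Rightarrow> 'a \<Rightarrow> 'a \<Rightarrow> bool" where
  "truth_set M p X \<longleftrightarrow> generated (truth_axiom M) (truth_rule M) (opair p X)"

lemma definable_truth_set [dfn]:
  assumes "definable_term s" "definable_term t"
  shows "definable (\<lambda>e. truth_set M (s e) (t e))"
  unfolding truth_set_def
  by (rule definable_generated; (unfold truth_axiom_def truth_rule_def)?; intro dfn assms)

lemma opair_app_simps:
  assumes "m \<epsilon> omega" "n \<epsilon> omega"
  shows "(is_fun a omega M \<and> (\<exists>x. opair m x \<epsilon> a \<and> (\<exists>y. opair n y \<epsilon> a \<and> x \<epsilon> y))) \<longleftrightarrow>
      is_fun a omega M \<and> app a m \<epsilon> app a n"
    and "(is_fun a omega M \<and> (\<exists>x. opair m x \<epsilon> a \<and> opair n x \<epsilon> a)) \<longleftrightarrow>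
      is_fun a omega M \<and> app a m = app a n"
  using is_fun_opair_iff[of a omega M] assms by metis+

text \<open>Codes of different shapes differ, so only the matching clause can justify the pair. This
  and the four lemmas that follow are the recursion equations of truth.\<close>

lemma truth_set_mem:
  assumes "m \<epsilon> omega" "n \<epsilon> omega"
  shows "truth_set M (code_mem m n) X \<longleftrightarrow>
    (\<forall>a. a \<epsilon> X \<longleftrightarrow> is_fun a omega M \<and> app a m \<epsilon> app a n)" (is "_ \<longleftrightarrow> ?R")
proof
  assume "truth_set M (code_mem m n) X"
  then show ?R unfolding truth_set_def
    by (cases rule: generated_cases)
       (auto simp: truth_axiom_def truth_rule_def opair_app_simps)
next
  assume ?R
  then have "truth_axiom M (opair (code_mem m n) X)"
    unfolding truth_axiom_def using assms
    by (intro exI[of _ m] exI[of _ n] exI[of _ X]) (simp add: opair_app_simps)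
  then show "truth_set M (code_mem m n) X" unfolding truth_set_def by (rule generated_axiom)
qed

lemma truth_set_eq:
  assumes "m \<epsilon> omega" "n \<epsilon> omega"
  shows "truth_set M (code_eq m n) X \<longleftrightarrow>
    (\<forall>a. a \<epsilon> X \<longleftrightarrow> is_fun a omega M \<and> app a m = app a n)" (is "_ \<longleftrightarrow> ?R")
proof
  assume "truth_set M (code_eq m n) X"
  then show ?R unfolding truth_set_def
    by (cases rule: generated_cases)
       (auto simp: truth_axiom_def truth_rule_def opair_app_simps)
next
  assume ?R
  then have "truth_axiom M (opair (code_eq m n) X)"
    unfolding truth_axiom_def using assms
    by (intro exI[of _ m] exI[of _ n] exI[of _ X]) (simp add: opair_app_simps)
  then show "truth_set M (code_eq m n) X" unfolding truth_set_def by (rule generated_axiom)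
qed

lemma truth_set_neg:
  "truth_set M (code_neg p) Z \<longleftrightarrow>
    (\<exists>X. truth_set M p X \<and> (\<forall>a. a \<epsilon> Z \<longleftrightarrow> is_fun a omega M \<and> \<not> a \<epsilon> X))" (is "_ \<longleftrightarrow> ?R")
proof
  assume "truth_set M (code_neg p) Z"
  then show ?R unfolding truth_set_def
    by (cases rule: generated_cases) (auto simp: truth_axiom_def truth_rule_def)
next
  assume ?R
  then obtain X where X: "truth_set M p X" "\<forall>a. a \<epsilon> Z \<longleftrightarrow> is_fun a omega M \<and> \<not> a \<epsilon> X" by blast
  \<comment> \<open>A single premise fills both premise positions.\<close>
  then have "truth_rule M (opair p X) (opair p X) (opair (code_neg p) Z)"
    unfolding truth_rule_def by auto
  then show "truth_set M (code_neg p) Z"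
    using X(1) generated_rule unfolding truth_set_def by blast
qed

lemma truth_set_and:
  "truth_set M (code_and p q) Z \<longleftrightarrow>
    (\<exists>X Y. truth_set M p X \<and> truth_set M q Y \<and> (\<forall>a. a \<epsilon> Z \<longleftrightarrow> a \<epsilon> X \<and> a \<epsilon> Y))" (is "_ \<longleftrightarrow> ?R")
proof
  assume "truth_set M (code_and p q) Z"
  then show ?R unfolding truth_set_def
    by (cases rule: generated_cases) (auto simp: truth_axiom_def truth_rule_def)
next
  assume ?R
  then obtain X Y where XY: "truth_set M p X" "truth_set M q Y" "\<forall>a. a \<epsilon> Z \<longleftrightarrow> a \<epsilon> X \<and> a \<epsilon> Y"
    by blast
  then have "truth_rule M (opair p X) (opair q Y) (opair (code_and p q) Z)"
    unfolding truth_rule_def by auto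
  then show "truth_set M (code_and p q) Z"
    using XY(1,2) generated_rule unfolding truth_set_def by blast
qed

lemma truth_set_ex:
  assumes "n \<epsilon> omega"
  shows "truth_set M (code_ex n p) Z \<longleftrightarrow> (\<exists>X. truth_set M p X \<and> (\<forall>a. a \<epsilon> Z \<longleftrightarrow>
    is_fun a omega M \<and> (\<exists>b. b \<epsilon> X \<and> is_fun b omega M \<and> agree_off n a b)))" (is "_ \<longleftrightarrow> ?R")
proof
  assume "truth_set M (code_ex n p) Z"
  then show ?R unfolding truth_set_def
    by (cases rule: generated_cases) (auto simp: truth_axiom_def truth_rule_def)
next
  assume ?R
  then obtain X where X: "truth_set M p X"
    "\<forall>a. a \<epsilon> Z \<longleftrightarrow> is_fun a omega M \<and> (\<exists>b. b \<epsilon> X \<and> is_fun b omega M \<and> agree_off n a b)" by blast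
  then have "truth_rule M (opair p X) (opair p X) (opair (code_ex n p) Z)"
    unfolding truth_rule_def using assms by auto
  then show "truth_set M (code_ex n p) Z"
    using X(1) generated_rule unfolding truth_set_def by blast
qed

lemma ex1_extension:
  assumes "\<exists>X. \<forall>a. a \<epsilon> X \<longleftrightarrow> Q a"
  shows "\<exists>!X. \<forall>a. a \<epsilon> X \<longleftrightarrow> Q a"
  using assms set_ext by metis

lemma ex_extension_funs:
  assumes "definable (\<lambda>e. Q (e 0))"
  shows "\<exists>X. \<forall>a. a \<epsilon> X \<longleftrightarrow> is_fun a A B \<and> Q a"
  using mem_sep[OF assms, of _ "funs A B"] by (metis mem_funs)

text \<open>By induction on formulas: the truth sets of the parts are unique, separation produces
  the next set, and extensionality makes it unique.\<close>

lemma truth_set_ex1: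
  assumes "is_formula p"
  shows "\<exists>!X. truth_set M p X"
proof -
  have "definable (\<lambda>e. \<exists>!X. truth_set M (e 0) X)" by (intro dfn)
  from this assms show ?thesis
  proof (induction rule: formula_induct)
    case (mem m n)
    have "\<exists>X. \<forall>a. a \<epsilon> X \<longleftrightarrow> is_fun a omega M \<and> (\<exists>x. opair m x \<epsilon> a \<and> (\<exists>y. opair n y \<epsilon> a \<and> x \<epsilon> y))"
      by (rule ex_extension_funs) (intro dfn)
    then have "\<exists>X. \<forall>a. a \<epsilon> X \<longleftrightarrow> is_fun a omega M \<and> app a m \<epsilon> app a n"
      unfolding opair_app_simps[OF mem] .
    then show ?case unfolding truth_set_mem[OF mem] by (rule ex1_extension)
  next
    case (eq m n)
    have "\<exists>X. \<forall>a. a \<epsilon> X \<longleftrightarrow> is_fun a omega M \<and> (\<exists>x. opair m x \<epsilon> a \<and> opair n x \<epsilon> a)"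
      by (rule ex_extension_funs) (intro dfn)
    then have "\<exists>X. \<forall>a. a \<epsilon> X \<longleftrightarrow> is_fun a omega M \<and> app a m = app a n"
      unfolding opair_app_simps[OF eq] .
    then show ?case unfolding truth_set_eq[OF eq] by (rule ex1_extension)
  next
    case (neg p)
    then obtain X where X: "\<And>Y. truth_set M p Y \<longleftrightarrow> Y = X" by metis
    have "\<exists>Z. \<forall>a. a \<epsilon> Z \<longleftrightarrow> is_fun a omega M \<and> \<not> a \<epsilon> X"
      by (rule ex_extension_funs) (intro dfn)
    from ex1_extension[OF this] show ?case unfolding truth_set_neg X by simp
  next
    case (conj p q)
    then obtain X Y where X: "\<And>Z. truth_set M p Z \<longleftrightarrow> Z = X" and Y: "\<And>Z. truth_set M q Z \<longleftrightarrow> Z = Y"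
      by metis
    have "definable (\<lambda>e. e 0 \<epsilon> Y)" by (intro dfn)
    from mem_sep[of "\<lambda>z. z \<epsilon> Y", OF this] have "\<exists>Z. \<forall>a. a \<epsilon> Z \<longleftrightarrow> a \<epsilon> X \<and> a \<epsilon> Y" by blast
    from ex1_extension[OF this] show ?case unfolding truth_set_and X Y by simp
  next
    case (ex n p)
    then obtain X where X: "\<And>Y. truth_set M p Y \<longleftrightarrow> Y = X" by metis
    have "\<exists>Z. \<forall>a. a \<epsilon> Z \<longleftrightarrow> is_fun a omega M \<and> (\<exists>b. b \<epsilon> X \<and> is_fun b omega M \<and> agree_off n a b)"
      by (rule ex_extension_funs) (intro dfn)
    from ex1_extension[OF this] show ?case unfolding truth_set_ex[OF ex(1)] X by simp
  qed
qed

definition sat_set :: "'a \<Rightarrow> 'a" where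
  "sat_set M = sep (prod fmls (funs omega M)) (\<lambda>z. \<exists>p a X. z = opair p a \<and> truth_set M p X \<and> a \<epsilon> X)"

lemma mem_sat_set:
  assumes "is_formula p" "is_fun a omega M" "truth_set M p X"
  shows "opair p a \<epsilon> sat_set M \<longleftrightarrow> a \<epsilon> X"
proof -
  have "definable (\<lambda>e. \<exists>p a X. e 0 = opair p a \<and> truth_set M p X \<and> a \<epsilon> X)" by (intro dfn)
  note mem_sep[of "\<lambda>z. \<exists>p a X. z = opair p a \<and> truth_set M p X \<and> a \<epsilon> X", OF this]
  then have "opair p a \<epsilon> sat_set M \<longleftrightarrow> (\<exists>X. truth_set M p X \<and> a \<epsilon> X)"
    unfolding sat_set_def using assms(1,2) by simp
  then show ?thesis using truth_set_ex1[OF assms(1)] assms(3) by blast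
qed

text \<open>Each Tarski clause is the corresponding equation for truth sets, read at a single
  assignment.\<close>

lemma satisfaction_relation_sat_set: "satisfaction_relation M (sat_set M)"
  unfolding satisfaction_relation_def
proof (intro allI impI conjI ballI)
  fix a assume a: "is_fun a omega M"
  fix m n assume "m \<in> elts omega" "n \<in> elts omega"
  then have mn: "m \<epsilon> omega" "n \<epsilon> omega" by auto
  obtain X where "truth_set M (code_mem m n) X"
    using truth_set_ex1[of "code_mem m n"] is_formula_code(1)[OF mn] by blast
  then show "opair (code_mem m n) a \<epsilon> sat_set M \<longleftrightarrow> app a m \<epsilon> app a n"
    using mem_sat_set[OF is_formula_code(1)[OF mn] a] truth_set_mem[OF mn] a by metis
  obtain X where "truth_set M (code_eq m n) X"
    using truth_set_ex1[of "code_eq m n"] is_formula_code(2)[OF mn] by blast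
  then show "opair (code_eq m n) a \<epsilon> sat_set M \<longleftrightarrow> app a m = app a n"
    using mem_sat_set[OF is_formula_code(2)[OF mn] a] truth_set_eq[OF mn] a by metis
next
  fix a p assume a: "is_fun a omega M" and p: "is_formula p"
  obtain Z where Z: "truth_set M (code_neg p) Z"
    using truth_set_ex1[OF is_formula_code(3)[OF p]] by blast
  then obtain X where "truth_set M p X" "\<forall>a. a \<epsilon> Z \<longleftrightarrow> is_fun a omega M \<and> \<not> a \<epsilon> X"
    unfolding truth_set_neg by blast
  then show "opair (code_neg p) a \<epsilon> sat_set M \<longleftrightarrow> \<not> opair p a \<epsilon> sat_set M"
    using mem_sat_set[OF _ a] p a Z by simp
next
  fix a p q assume a: "is_fun a omega M" and pq: "is_formula p \<and> is_formula q"
  obtain Z where Z: "truth_set M (code_and p q) Z"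
    using truth_set_ex1[OF is_formula_code(4)] pq by blast
  then obtain X Y where "truth_set M p X" "truth_set M q Y" "\<forall>a. a \<epsilon> Z \<longleftrightarrow> a \<epsilon> X \<and> a \<epsilon> Y"
    unfolding truth_set_and by blast
  then show "opair (code_and p q) a \<epsilon> sat_set M \<longleftrightarrow>
      opair p a \<epsilon> sat_set M \<and> opair q a \<epsilon> sat_set M"
    using mem_sat_set[OF _ a] pq a Z by simp
next
  fix a p n assume a: "is_fun a omega M" and p: "is_formula p" and "n \<in> elts omega"
  then have n: "n \<epsilon> omega" by simp
  obtain Z where Z: "truth_set M (code_ex n p) Z"
    using truth_set_ex1[OF is_formula_code(5)[OF n p]] by blast
  then obtain X where X: "truth_set M p X"
    "\<forall>a. a \<epsilon> Z \<longleftrightarrow> is_fun a omega M \<and> (\<exists>b. b \<epsilon> X \<and> is_fun b omega M \<and> agree_off n a b)"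
    unfolding truth_set_ex[OF n] by blast
  have "opair (code_ex n p) a \<epsilon> sat_set M \<longleftrightarrow>
      (\<exists>b. b \<epsilon> X \<and> is_fun b omega M \<and> agree_off n a b)"
    using mem_sat_set[OF _ a Z] p a X(2) n by simp
  then show "opair (code_ex n p) a \<epsilon> sat_set M \<longleftrightarrow>
      (\<exists>b. is_fun b omega M \<and> (\<forall>k\<in>elts omega. k \<noteq> n \<longrightarrow> app b k = app a k) \<and>
        opair p b \<epsilon> sat_set M)"
    using mem_sat_set[OF p _ X(1)] agree_off_iff[OF a] by blast
qed

lemma satisfaction_relation_code:
  assumes "satisfaction_relation M S" "is_fun a omega M"
  shows "m \<epsilon> omega \<Longrightarrow> n \<epsilon> omega \<Longrightarrow> opair (code_mem m n) a \<epsilon> S \<longleftrightarrow> app a m \<epsilon> app a n"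
    and "m \<epsilon> omega \<Longrightarrow> n \<epsilon> omega \<Longrightarrow> opair (code_eq m n) a \<epsilon> S \<longleftrightarrow> app a m = app a n"
    and "is_formula p \<Longrightarrow> opair (code_neg p) a \<epsilon> S \<longleftrightarrow> \<not> opair p a \<epsilon> S"
    and "is_formula p \<Longrightarrow> is_formula q \<Longrightarrow>
      opair (code_and p q) a \<epsilon> S \<longleftrightarrow> opair p a \<epsilon> S \<and> opair q a \<epsilon> S"
    and "n \<epsilon> omega \<Longrightarrow> is_formula p \<Longrightarrow> opair (code_ex n p) a \<epsilon> S \<longleftrightarrow>
      (\<exists>b. is_fun b omega M \<and> (\<forall>k. k \<epsilon> omega \<longrightarrow> k \<noteq> n \<longrightarrow> app b k = app a k) \<and> opair p b \<epsilon> S)"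
  using assms(1)[unfolded satisfaction_relation_def, rule_format, OF assms(2)]
  by (simp_all add: Ball_def)

lemma satisfaction_relation_unique:
  assumes S: "satisfaction_relation M S" and S': "satisfaction_relation M S'"
    and "is_formula p"
  shows "\<forall>a. is_fun a omega M \<longrightarrow> (opair p a \<epsilon> S \<longleftrightarrow> opair p a \<epsilon> S')"
proof -
  have "definable (\<lambda>e. \<forall>a. is_fun a omega M \<longrightarrow> (opair (e 0) a \<epsilon> S \<longleftrightarrow> opair (e 0) a \<epsilon> S'))"
    by (intro dfn)
  from this \<open>is_formula p\<close> show ?thesis
    by (induction rule: formula_induct)
      (simp_all add: satisfaction_relation_code[OF S] satisfaction_relation_code[OF S'] cong: conj_cong)
qed

text \<open>Existence and uniqueness collapse the quantifier over satisfaction relations to one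
  fixed set, which can serve as a parameter in definitions.\<close>

lemma satisfies_iff:
  assumes "is_formula p" "is_fun a omega M"
  shows "satisfies M p a \<longleftrightarrow> opair p a \<epsilon> sat_set M"
  unfolding satisfies_def
  using satisfaction_relation_sat_set satisfaction_relation_unique assms by blast

lemma satisfies_code:
  assumes "is_fun a omega M"
  shows "m \<epsilon> omega \<Longrightarrow> n \<epsilon> omega \<Longrightarrow> satisfies M (code_mem m n) a \<longleftrightarrow> app a m \<epsilon> app a n"
    and "m \<epsilon> omega \<Longrightarrow> n \<epsilon> omega \<Longrightarrow> satisfies M (code_eq m n) a \<longleftrightarrow> app a m = app a n"
    and "is_formula p \<Longrightarrow> satisfies M (code_neg p) a \<longleftrightarrow> \<not> satisfies M p a"
    and "is_formula p \<Longrightarrow> is_formula q \<Longrightarrow>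
      satisfies M (code_and p q) a \<longleftrightarrow> satisfies M p a \<and> satisfies M q a"
    and "n \<epsilon> omega \<Longrightarrow> is_formula p \<Longrightarrow> satisfies M (code_ex n p) a \<longleftrightarrow>
      (\<exists>b. is_fun b omega M \<and> (\<forall>k. k \<epsilon> omega \<longrightarrow> k \<noteq> n \<longrightarrow> app b k = app a k) \<and> satisfies M p b)"
  using satisfaction_relation_code[OF satisfaction_relation_sat_set assms] assms
  by (simp_all add: satisfies_iff cong: conj_cong)

subsection \<open>Elementary embeddings\<close>

definition upd :: "'a \<Rightarrow> 'a \<Rightarrow> 'a \<Rightarrow> 'a \<Rightarrow> 'a" where
  "upd M a n y = sep (prod omega M) (\<lambda>z. \<exists>k x. z = opair k x \<and> (k = n \<and> x = y \<or> k \<noteq> n \<and> opair k x \<epsilon> a))"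

lemma upd:
  assumes "is_fun a omega M" "y \<epsilon> M"
  shows is_fun_upd: "is_fun (upd M a n y) omega M"
    and app_upd: "k \<epsilon> omega \<Longrightarrow> app (upd M a n y) k = (if k = n then y else app a k)"
proof -
  have "definable (\<lambda>e. \<exists>k x. e 0 = opair k x \<and> (k = n \<and> x = y \<or> k \<noteq> n \<and> opair k x \<epsilon> a))"
    by (intro dfn)
  note mem_sep[of "\<lambda>z. \<exists>k x. z = opair k x \<and> (k = n \<and> x = y \<or> k \<noteq> n \<and> opair k x \<epsilon> a)", OF this]
  then have mem: "z \<epsilon> upd M a n y \<longleftrightarrow> (\<exists>k. k \<epsilon> omega \<and> z = opair k (if k = n then y else app a k))" for z
    unfolding upd_def using assms is_fun_app(2)[OF assms(1)] by (auto simp: is_fun_opair_iff[OF assms(1)])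
  show fn: "is_fun (upd M a n y) omega M"
    unfolding is_fun_def using assms is_fun_app(2)[OF assms(1)] by (auto simp: mem)
  show "k \<epsilon> omega \<Longrightarrow> app (upd M a n y) k = (if k = n then y else app a k)"
    using is_fun_opair_iff[OF fn, of k "if k = n then y else app a k"] by (simp add: mem)
qed

text \<open>An assignment agreeing with \<open>a\<close> off \<open>n\<close> is determined by its
  value at \<open>n\<close>, so the witness can be taken to be an element of
  \<open>M\<close>.\<close>

lemma satisfies_ex:
  assumes a: "is_fun a omega M" and n: "n \<epsilon> omega" and p: "is_formula p"
  shows "satisfies M (code_ex n p) a \<longleftrightarrow> (\<exists>y. y \<epsilon> M \<and> satisfies M p (upd M a n y))"
proof
  assume "satisfies M (code_ex n p) a"
  then obtain b where b: "is_fun b omega M" "\<And>k. k \<epsilon> omega \<Longrightarrow> k \<noteq> n \<Longrightarrow> app b k = app a k"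
    "satisfies M p b"
    using satisfies_code(5)[OF a n p] by blast
  have "app b n \<epsilon> M" using is_fun_app(2)[OF b(1) n] .
  moreover have "b = upd M a n (app b n)"
    by (rule fun_ext[OF b(1) is_fun_upd[OF a \<open>app b n \<epsilon> M\<close>]])
      (simp add: app_upd[OF a \<open>app b n \<epsilon> M\<close>] b(2))
  ultimately show "\<exists>y. y \<epsilon> M \<and> satisfies M p (upd M a n y)" using b(3) by metis
next
  assume "\<exists>y. y \<epsilon> M \<and> satisfies M p (upd M a n y)"
  then obtain y where "y \<epsilon> M" "satisfies M p (upd M a n y)" by blast
  then show "satisfies M (code_ex n p) a"
    unfolding satisfies_code(5)[OF a n p]
    by (intro exI[of _ "upd M a n y"]) (simp add: is_fun_upd a app_upd)
qed

text \<open>The formulas evaluated below have at most three free variables; the constant tail puts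
  \<open>z\<close> at variable 2 and makes the assignment total.\<close>

definition assignment :: "'a \<Rightarrow> 'a \<Rightarrow> 'a \<Rightarrow> 'a \<Rightarrow> 'a" where
  "assignment M x y z = upd M (upd M (prod omega (upair z z)) zero x) (succ zero) y"

lemma is_fun_constant: "z \<epsilon> M \<Longrightarrow> is_fun (prod A (upair z z)) A M"
  unfolding is_fun_def by auto

lemma app_constant: "z \<epsilon> M \<Longrightarrow> k \<epsilon> A \<Longrightarrow> app (prod A (upair z z)) k = z"
  using is_fun_opair_iff[OF is_fun_constant, of z M k z A] by simp

lemma assignment:
  assumes "x \<epsilon> M" "y \<epsilon> M" "z \<epsilon> M"
  shows is_fun_assignment: "is_fun (assignment M x y z) omega M"
    and app_assignment: "k \<epsilon> omega \<Longrightarrow> app (assignment M x y z) k =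
      (if k = zero then x else if k = succ zero then y else z)"
  unfolding assignment_def using assms
  by (simp_all add: is_fun_upd app_upd is_fun_constant app_constant)

text \<open>Composing such an assignment with \<open>j\<close> gives the assignment built from the
  images, so elementarity applies directly.\<close>

lemma elementary_assignment:
  assumes j: "elementary_embedding j M M" and "is_formula p" and xyz: "x \<epsilon> M" "y \<epsilon> M" "z \<epsilon> M"
  shows "satisfies M p (assignment M x y z) \<longleftrightarrow>
    satisfies M p (assignment M (app j x) (app j y) (app j z))"
proof -
  have fn: "is_fun j M M" using j unfolding elementary_embedding_def by blast
  note images = is_fun_app(2)[OF fn xyz(1)] is_fun_app(2)[OF fn xyz(2)] is_fun_app(2)[OF fn xyz(3)]
  show ?thesis
    using j \<open>is_formula p\<close> is_fun_assignment[OF xyz] is_fun_assignment[OF images]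
      app_assignment[OF xyz] app_assignment[OF images]
    unfolding elementary_embedding_def by simp
qed

lemma elementary_embedding_mem:
  assumes j: "elementary_embedding j M M" and xy: "x \<epsilon> M" "y \<epsilon> M"
  shows "app j x \<epsilon> app j y \<longleftrightarrow> x \<epsilon> y"
proof -
  have fn: "is_fun j M M" using j unfolding elementary_embedding_def by blast
  note images = is_fun_app(2)[OF fn xy(1)] is_fun_app(2)[OF fn xy(2)]
  show ?thesis
    using elementary_assignment[OF j, of "code_mem zero (succ zero)" x y y] xy images
    by (simp add: satisfies_code is_fun_assignment app_assignment)
qed

text \<open>Belonging to no element of \<open>M\<close> is expressed by a formula in one free
  variable, so it passes to the image.\<close>

lemma elementary_embedding_maximal:
  assumes j: "elementary_embedding j M M" and x: "x \<epsilon> M" "\<And>y. y \<epsilon> M \<Longrightarrow> \<not> x \<epsilon> y" and "y \<epsilon> M"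
  shows "\<not> app j x \<epsilon> y"
proof -
  have fn: "is_fun j M M" using j unfolding elementary_embedding_def by blast
  show ?thesis
    using elementary_assignment[OF j, of "code_neg (code_ex (succ zero) (code_mem zero (succ zero)))" x x x]
      x is_fun_app(2)[OF fn x(1)] \<open>y \<epsilon> M\<close>
    by (simp add: satisfies_code(1-4) satisfies_ex is_fun_assignment app_assignment is_fun_upd app_upd)
qed

lemma elementary_embedding_upair:
  assumes j: "elementary_embedding j M M" and M: "transitive M"
    and xyz: "x \<epsilon> M" "y \<epsilon> M" "upair x y \<epsilon> M"
  shows "app j (upair x y) = upair (app j x) (app j y)"
proof (rule set_ext)
  have fn: "is_fun j M M" using j unfolding elementary_embedding_def by blast
  note images = is_fun_app(2)[OF fn xyz(1)] is_fun_app(2)[OF fn xyz(2)] is_fun_app(2)[OF fn xyz(3)]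
  let ?three = "succ (succ (succ zero))"
  \<comment> \<open>With variables 0, 1, 2 holding the pair and its two members, \<open>?p\<close>
    says that the pair has no further member.\<close>
  let ?p = "code_neg (code_ex ?three (code_and (code_mem ?three zero)
    (code_and (code_neg (code_eq ?three (succ zero))) (code_neg (code_eq ?three (succ (succ zero)))))))"
  have "\<And>z. z \<epsilon> M \<Longrightarrow> z \<epsilon> app j (upair x y) \<Longrightarrow> z = app j x \<or> z = app j y"
    using elementary_assignment[OF j, of ?p "upair x y" x y] xyz images
    by (auto simp add: satisfies_code(1-4) satisfies_ex is_fun_assignment app_assignment is_fun_upd app_upd)
  \<comment> \<open>Satisfaction of \<open>?p\<close> concerns elements of \<open>M\<close> only; by
    transitivity this covers every member of the image.\<close>
  moreover have "z \<epsilon> M" if "z \<epsilon> app j (upair x y)" for z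
    using M images(3) that unfolding transitive_def by (auto simp: subset_iff)
  moreover have "app j x \<epsilon> app j (upair x y)" "app j y \<epsilon> app j (upair x y)"
    using xyz by (simp_all add: elementary_embedding_mem[OF j])
  ultimately show "z \<epsilon> app j (upair x y) \<longleftrightarrow> z \<epsilon> upair (app j x) (app j y)" for z
    by auto
qed

lemma transitive_memD: "transitive M \<Longrightarrow> x \<epsilon> y \<Longrightarrow> y \<epsilon> M \<Longrightarrow> x \<epsilon> M"
  unfolding transitive_def by (auto simp: subset_iff)

lemma transitive_opairD:
  assumes "transitive M" "opair x y \<epsilon> M"
  shows "x \<epsilon> M" "y \<epsilon> M" "upair x x \<epsilon> M" "upair x y \<epsilon> M"
proof -
  show *: "upair x x \<epsilon> M" "upair x y \<epsilon> M"
    using transitive_memD[OF assms(1) _ assms(2)] unfolding opair_def by auto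
  show "x \<epsilon> M" "y \<epsilon> M"
    using transitive_memD[OF assms(1) _ *(2)] by auto
qed

lemma elementary_embedding_opair:
  assumes j: "elementary_embedding j M M" and M: "transitive M" and xy: "opair x y \<epsilon> M"
  shows "app j (opair x y) = opair (app j x) (app j y)"
  using xy transitive_opairD[OF M xy] unfolding opair_def
  by (simp add: elementary_embedding_upair[OF j M])

text \<open>
  Placing \<open>{T, t}\<close> on top of a transitive \<open>T\<close> containing \<open>t\<close> makes \<open>t\<close> definable: \<open>{T, t}\<close> is the only
  element of \<open>M\<close> that belongs to no other, and \<open>t\<close> is the element of it that belongs to the other one.
\<close>

lemma definable_pointE:
  obtains M where "transitive M" "t \<epsilon> M" "\<And>j. elementary_embedding j M M \<Longrightarrow> app j t = t"
proof -
  obtain T where T: "transitive T" "elts (upair t t) \<subseteq> elts T" by (rule transitive_supersetE)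
  then have tT: "t \<epsilon> T" by (auto simp: subset_iff)
  define s where "s = upair T t"
  define M where "M = union2 T (upair T s)"
  have M: "transitive M"
    unfolding transitive_def
    using transitive_memD[OF T(1)] tT by (auto simp: subset_iff M_def s_def)
  have in_M: "T \<epsilon> M" "s \<epsilon> M" "t \<epsilon> M" using tT by (auto simp: M_def)
  have "\<not> s \<epsilon> T" using transitive_memD[OF T(1), of T s] by (auto simp: s_def)
  then have top: "\<not> s \<epsilon> y" if "y \<epsilon> M" for y
    using that transitive_memD[OF T(1), of s y] unfolding M_def mem_union2 mem_upair by auto
  have "app j t = t" if j: "elementary_embedding j M M" for j
  proof -
    have "is_fun j M M" using j unfolding elementary_embedding_def by blast
    then have "app j s \<epsilon> M" using in_M(2) by (rule is_fun_app(2))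
    moreover have "\<not> app j s \<epsilon> y" if "y \<epsilon> M" for y
      using elementary_embedding_maximal[OF j in_M(2) top that] .
    then have "\<not> app j s \<epsilon> T" "\<not> app j s \<epsilon> s" using in_M by auto
    ultimately have "app j s = s" unfolding M_def by (auto simp: s_def)
    then have "upair (app j T) (app j t) = upair T t"
      using elementary_embedding_upair[OF j M in_M(1,3)] in_M(2) unfolding s_def by simp
    \<comment> \<open>The equation of pairs also allows \<open>j\<close> to swap \<open>T\<close>
      and \<open>t\<close>; that would give \<open>T \<epsilon> t\<close> against
      \<open>t \<epsilon> T\<close>.\<close>
    moreover have "app j t \<epsilon> app j T" using elementary_embedding_mem[OF j in_M(3,1)] tT by simp
    ultimately show ?thesis unfolding upair_eq_iff using tT mem_asym by metis
  qed
  then show ?thesis using that M in_M(3) by blast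
qed

section \<open>From proto Berkeley cardinals to endomorphisms\<close>

lemma proto_berkeley_endomorphism:
  assumes "proto_berkeley \<delta>" and G: "is_graph G R" and f: "is_injection f \<delta> G"
  shows "\<exists>h. is_endomorphism h G R \<and> (\<exists>y\<in>app f ` elts \<delta>. app h y \<noteq> y)"
proof -
  \<comment> \<open>All data are packed into one point, so fixing it fixes each component and
    transitivity puts \<delta> into \<open>M\<close>.\<close>
  define t where "t = opair (opair G R) (opair f \<delta>)"
  obtain M where M: "transitive M" and t: "t \<epsilon> M" and fix_t: "\<And>j. elementary_embedding j M M \<Longrightarrow> app j t = t"
    by (rule definable_pointE[of t]) blast
  have in_M: "opair G R \<epsilon> M" "opair f \<delta> \<epsilon> M" "G \<epsilon> M" "R \<epsilon> M" "f \<epsilon> M" "\<delta> \<epsilon> M"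
    using t transitive_opairD[OF M] unfolding t_def by blast+
  obtain j \<kappa> where j: "elementary_embedding j M M" and \<kappa>: "is_critical_point j M \<kappa>" "\<kappa> \<epsilon> \<delta>"
    using \<open>proto_berkeley \<delta>\<close> M in_M(6) unfolding proto_berkeley_def by blast
  have fn: "is_fun j M M" using j unfolding elementary_embedding_def by blast
  have j_fix: "app j G = G" "app j R = R" "app j f = f" "app j \<delta> = \<delta>"
    using fix_t[OF j] elementary_embedding_opair[OF j M] t in_M(1,2) unfolding t_def by simp_all
  have j_mem: "app j x \<epsilon> app j y" if "x \<epsilon> y" "y \<epsilon> M" for x y
    using elementary_embedding_mem[OF j] transitive_memD[OF M that] that by simp
  have j_opair: "opair (app j x) (app j y) \<epsilon> app j u" if "opair x y \<epsilon> u" "u \<epsilon> M" for x y u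
    using j_mem[OF that] elementary_embedding_opair[OF j M] transitive_memD[OF M that] by simp
  have G_M: "x \<epsilon> M" if "x \<epsilon> G" for x using transitive_memD[OF M that in_M(3)] .
  obtain h where h: "is_fun h G G" "\<And>x. x \<epsilon> G \<Longrightarrow> app h x = app j x"
  proof (rule functionE[of "\<lambda>x y. opair x y \<epsilon> j" G "app j" G])
    show "definable (\<lambda>e. opair (e k) (e l) \<epsilon> j)" for k l by (intro dfn)
    show "app j x \<epsilon> G" if "x \<epsilon> G" for x using j_mem[OF that in_M(3)] j_fix(1) by simp
    show "opair x y \<epsilon> j \<longleftrightarrow> y = app j x" if "x \<epsilon> G" for x y
      using is_fun_opair_iff[OF fn] G_M[OF that] by simp
  qed blast
  have "is_endomorphism h G R"
    unfolding is_endomorphism_def using h j_opair[of _ _ R] in_M(4) j_fix(2) by simp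
  moreover have "app h (app f \<kappa>) \<noteq> app f \<kappa>"
  proof
    have f_fun: "is_fun f \<delta> G" and f_inj: "inj_on (app f) (elts \<delta>)"
      using f unfolding is_injection_def by auto
    have "app f \<kappa> \<epsilon> G" using is_fun_app(2)[OF f_fun \<kappa>(2)] .
    moreover assume "app h (app f \<kappa>) = app f \<kappa>"
    ultimately have "app j (app f \<kappa>) = app f \<kappa>" using h(2) by simp
    \<comment> \<open>The pair of \<kappa> and its value is sent into \<open>app j f = f\<close>. If
      the value is fixed, injectivity of \<open>f\<close> fixes \<kappa> as well.\<close>
    moreover have "opair (app j \<kappa>) (app j (app f \<kappa>)) \<epsilon> f"
      using j_opair[OF is_fun_app(1)[OF f_fun \<kappa>(2)] in_M(5)] j_fix(3) by simp
    ultimately have "app j \<kappa> \<epsilon> \<delta>" "app f (app j \<kappa>) = app f \<kappa>"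
      using is_fun_opair_iff[OF f_fun] by auto
    then have "app j \<kappa> = \<kappa>" using f_inj \<kappa>(2) by (auto dest: inj_onD)
    then show False using \<kappa>(1) unfolding is_critical_point_def by blast
  qed
  moreover have "app f \<kappa> \<in> app f ` elts \<delta>" using \<kappa>(2) by simp
  ultimately show ?thesis by blast
qed

subsection \<open>Hartogs numbers\<close>

lemma is_ordinal_mem: "is_ordinal \<alpha> \<Longrightarrow> \<beta> \<epsilon> \<alpha> \<Longrightarrow> is_ordinal \<beta>"
  unfolding is_ordinal_def Ball_def elts_iff using transitive_memD by blast

lemma definable_is_ordinal [dfn]: "definable_term s \<Longrightarrow> definable (\<lambda>e. is_ordinal (s e))"
  by (rule definable_subst1) (unfold is_ordinal_def transitive_def, intro dfn)

text \<open>Double membership induction: if \<alpha> and \<beta> were incomparable, comparability of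
  their members together with transitivity would give them the same members.\<close>

lemma ordinal_trichotomy:
  assumes "is_ordinal \<alpha>" "is_ordinal \<beta>"
  shows "\<alpha> \<epsilon> \<beta> \<or> \<alpha> = \<beta> \<or> \<beta> \<epsilon> \<alpha>"
proof -
  let ?C = "\<lambda>\<alpha> \<beta>. \<alpha> \<epsilon> \<beta> \<or> \<alpha> = \<beta> \<or> \<beta> \<epsilon> \<alpha>"
  have "definable (\<lambda>e. is_ordinal (e 0) \<longrightarrow> (\<forall>\<beta>. is_ordinal \<beta> \<longrightarrow> ?C (e 0) \<beta>))" by (intro dfn)
  then have "is_ordinal \<alpha> \<longrightarrow> (\<forall>\<beta>. is_ordinal \<beta> \<longrightarrow> ?C \<alpha> \<beta>)"
  proof (induction \<alpha> rule: mem_induct)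
    case (step \<alpha>)
    show ?case
    proof (intro impI allI)
      fix \<beta> assume \<alpha>: "is_ordinal \<alpha>" and "is_ordinal \<beta>"
      have "definable (\<lambda>e. is_ordinal (e 0) \<longrightarrow> ?C \<alpha> (e 0))" by (intro dfn)
      then have "is_ordinal \<beta> \<longrightarrow> ?C \<alpha> \<beta>"
      proof (induction \<beta> rule: mem_induct)
        case (step \<beta>)
        show ?case
        proof (intro impI)
          assume \<beta>: "is_ordinal \<beta>"
          have trans: "transitive \<alpha>" "transitive \<beta>" using \<alpha> \<beta> unfolding is_ordinal_def by auto
          have IH1: "?C x \<beta>" if "x \<epsilon> \<alpha>" for x
            using \<open>\<And>x. x \<epsilon> \<alpha> \<Longrightarrow> is_ordinal x \<longrightarrow> (\<forall>\<beta>. is_ordinal \<beta> \<longrightarrow> ?C x \<beta>)\<close> that \<beta>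
              is_ordinal_mem[OF \<alpha>] by blast
          have IH2: "?C \<alpha> y" if "y \<epsilon> \<beta>" for y using step that is_ordinal_mem[OF \<beta>] by blast
          show "?C \<alpha> \<beta>"
          proof (rule ccontr)
            assume *: "\<not> ?C \<alpha> \<beta>"
            have "x \<epsilon> \<beta>" if "x \<epsilon> \<alpha>" for x
              using IH1[OF that] * that transitive_memD[OF trans(1)] by blast
            moreover have "y \<epsilon> \<alpha>" if "y \<epsilon> \<beta>" for y
              using IH2[OF that] * that transitive_memD[OF trans(2)] by blast
            ultimately have "\<alpha> = \<beta>" by (intro set_ext) blast
            then show False using * by blast
          qed
        qed
      qed
      then show "?C \<alpha> \<beta>" using \<open>is_ordinal \<beta>\<close> by blast
    qed
  qed
  then show ?thesis using assms by blast
qed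

section \<open>Recovering an ordinal from its order transported to \<open>G\<close>\<close>

text \<open>\<open>r\<close> is the image of the non-strict order. The diagonal records the range of
  \<open>g\<close>, which distinguishes the one-element ordinal from the empty one.\<close>

definition transports :: "'a \<Rightarrow> 'a \<Rightarrow> 'a \<Rightarrow> bool" where
  "transports g \<beta> r \<longleftrightarrow> (\<forall>z. z \<epsilon> r \<longleftrightarrow> (\<exists>x y u v. x \<epsilon> \<beta> \<and> y \<epsilon> \<beta> \<and> (x \<epsilon> y \<or> x = y) \<and>
     opair x u \<epsilon> g \<and> opair y v \<epsilon> g \<and> z = opair u v))"

lemma definable_transports [dfn]:
  "definable_term s \<Longrightarrow> definable_term t \<Longrightarrow> definable_term u \<Longrightarrow>
    definable (\<lambda>e. transports (s e) (t e) (u e))"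
  by (rule definable_subst3) (unfold transports_def, intro dfn)

lemma transports_mem:
  assumes "is_injection g \<beta> G" "transports g \<beta> r"
  shows "z \<epsilon> r \<longleftrightarrow>
    (\<exists>x y. x \<epsilon> \<beta> \<and> y \<epsilon> \<beta> \<and> (x \<epsilon> y \<or> x = y) \<and> z = opair (app g x) (app g y))"
proof -
  have g: "is_fun g \<beta> G" using assms(1) unfolding is_injection_def by blast
  show ?thesis
    using assms(2)[unfolded transports_def is_fun_opair_iff[OF g], rule_format, of z] by blast
qed

lemma transports_iff:
  assumes g: "is_injection g \<beta> G" "transports g \<beta> r" and xy: "x \<epsilon> \<beta>" "y \<epsilon> \<beta>"
  shows "opair (app g x) (app g y) \<epsilon> r \<longleftrightarrow> x \<epsilon> y \<or> x = y"
proof -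
  have "app g x = app g y \<longleftrightarrow> x = y" if "x \<epsilon> \<beta>" "y \<epsilon> \<beta>" for x y
    using g(1) that unfolding is_injection_def inj_on_def by auto
  then show ?thesis unfolding transports_mem[OF g] using xy by (auto cong: conj_cong)
qed

lemma transports_range:
  assumes g: "is_injection g \<beta> G" "transports g \<beta> r" and "opair u v \<epsilon> r"
  obtains x y where "x \<epsilon> \<beta>" "y \<epsilon> \<beta>" "u = app g x" "v = app g y"
  using assms(3) that unfolding transports_mem[OF g] by auto

text \<open>The isomorphism between two ordinals with the same transported order is the identity: by
  membership induction \<open>g\<close> and \<open>g'\<close> agree on \<beta>, which places its
  members in \<beta>'.\<close>

lemma transports_subset:
  assumes \<beta>: "transitive \<beta>" "transitive \<beta>'"
    and g: "is_injection g \<beta> G" "transports g \<beta> r" and g': "is_injection g' \<beta>' G" "transports g' \<beta>' r"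
    and "x \<epsilon> \<beta>"
  shows "x \<epsilon> \<beta>'"
proof -
  have fn: "is_fun g \<beta> G" "is_fun g' \<beta>' G"
    and inj: "app g x = app g y \<Longrightarrow> x \<epsilon> \<beta> \<Longrightarrow> y \<epsilon> \<beta> \<Longrightarrow> x = y"
      "app g' x = app g' y \<Longrightarrow> x \<epsilon> \<beta>' \<Longrightarrow> y \<epsilon> \<beta>' \<Longrightarrow> x = y" for x y
    using g(1) g'(1) unfolding is_injection_def inj_on_def by auto
  have "definable (\<lambda>e. e 0 \<epsilon> \<beta> \<longrightarrow> (\<exists>u. opair (e 0) u \<epsilon> g \<and> opair (e 0) u \<epsilon> g'))" by (intro dfn)
  then have "x \<epsilon> \<beta> \<longrightarrow> (\<exists>u. opair x u \<epsilon> g \<and> opair x u \<epsilon> g')"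
  proof (induction x rule: mem_induct)
    case (step x)
    show ?case
    proof
      assume x: "x \<epsilon> \<beta>"
      have IH: "y \<epsilon> \<beta>" "y \<epsilon> \<beta>'" "app g y = app g' y" if "y \<epsilon> x" for y
      proof -
        show "y \<epsilon> \<beta>" using transitive_memD[OF \<beta>(1) that x] .
        then show "y \<epsilon> \<beta>'" "app g y = app g' y"
          using step[OF that] fn by (auto simp: is_fun_opair_iff)
      qed
      \<comment> \<open>The diagonal of \<open>r\<close> puts \<open>app g x\<close> into the range
        of \<open>g'\<close>.\<close>
      have "opair (app g x) (app g x) \<epsilon> r" using transports_iff[OF g x x] by simp
      then obtain x' where x': "x' \<epsilon> \<beta>'" "app g x = app g' x'"
        by (rule transports_range[OF g'])
      \<comment> \<open>Members of \<open>x\<close> and \<open>x'\<close> correspond through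
        \<open>r\<close>; the induction hypothesis and injectivity turn the correspondence into
        equality.\<close>
      have "x = x'"
      proof (rule set_ext, rule iffI)
        fix y assume y: "y \<epsilon> x"
        then have "opair (app g y) (app g x) \<epsilon> r" using transports_iff[OF g _ x] IH by blast
        then have "y \<epsilon> x' \<or> y = x'"
          using transports_iff[OF g' IH(2)[OF y] x'(1)] IH(3)[OF y] x'(2) by simp
        moreover have "y \<noteq> x'"
          using inj(1)[of y x] IH[OF y] x x' y mem_irrefl by metis
        ultimately show "y \<epsilon> x'" by blast
      next
        fix y assume y: "y \<epsilon> x'"
        then have y': "y \<epsilon> \<beta>'" using transitive_memD[OF \<beta>(2) y x'(1)] by blast
        then have "opair (app g' y) (app g x) \<epsilon> r" using transports_iff[OF g' y' x'(1)] x'(2) y by simp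
        then obtain a where a: "a \<epsilon> \<beta>" "app g' y = app g a" by (rule transports_range[OF g])
        then have "a \<epsilon> x \<or> a = x"
          using transports_iff[OF g a(1) x] \<open>opair (app g' y) (app g x) \<epsilon> r\<close> by simp
        moreover have "a \<noteq> x" using inj(2)[of y x'] a x' y y' mem_irrefl by metis
        ultimately have "a \<epsilon> x" by blast
        then have "a = y" using inj(2)[of a y] IH a y' by metis
        then show "y \<epsilon> x" using \<open>a \<epsilon> x\<close> by simp
      qed
      then show "\<exists>u. opair x u \<epsilon> g \<and> opair x u \<epsilon> g'"
        using x x' is_fun_app(1)[OF fn(1)] is_fun_app(1)[OF fn(2)] by metis
    qed
  qed
  then show ?thesis using \<open>x \<epsilon> \<beta>\<close> fn(2) by (auto simp: is_fun_opair_iff)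
qed

lemma is_injection_restrict:
  assumes g: "is_injection g B G" and "elts A \<subseteq> elts B"
  shows "\<exists>f. is_injection f A G"
proof -
  have fn: "is_fun g B G" using g unfolding is_injection_def by blast
  have A: "x \<epsilon> B" if "x \<epsilon> A" for x using assms(2) that by (auto simp: subset_iff)
  obtain f where f: "is_fun f A G" "\<And>x. x \<epsilon> A \<Longrightarrow> app f x = app g x"
  proof (rule functionE[of "\<lambda>x y. opair x y \<epsilon> g" A "app g" G])
    show "definable (\<lambda>e. opair (e k) (e l) \<epsilon> g)" for k l by (intro dfn)
    show "app g x \<epsilon> G" if "x \<epsilon> A" for x using is_fun_app(2)[OF fn A[OF that]] .
    show "opair x y \<epsilon> g \<longleftrightarrow> y = app g x" if "x \<epsilon> A" for x y
      using is_fun_opair_iff[OF fn] A[OF that] by simp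
  qed blast
  then have "is_injection f A G"
    using g A unfolding is_injection_def inj_on_def by auto
  then show ?thesis by blast
qed

text \<open>A relation on \<open>G\<close> determines the ordinal whose order it transports, so
  replacement over all relations on \<open>G\<close> collects the injectable ordinals without
  choosing injections.\<close>

lemma injectable_ordinals_setE:
  obtains B where "\<And>\<beta>. \<beta> \<epsilon> B \<longleftrightarrow> is_ordinal \<beta> \<and> (\<exists>g. is_injection g \<beta> G)"
proof -
  define P where "P r \<beta> \<longleftrightarrow> is_ordinal \<beta> \<and> (\<exists>g. is_injection g \<beta> G \<and> transports g \<beta> r)" for r \<beta>
  have dfnP: "definable (\<lambda>e. P (e 0) (e 1))" unfolding P_def by (intro dfn)
  have functional: "\<beta> = \<beta>'" if "r \<epsilon> pow (prod G G)" "P r \<beta>" "P r \<beta>'" for r \<beta> \<beta>'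
  proof -
    have "transitive \<beta>" "transitive \<beta>'" using that unfolding P_def is_ordinal_def by auto
    obtain g where "is_injection g \<beta> G" "transports g \<beta> r"
      using \<open>P r \<beta>\<close> unfolding P_def by blast
    moreover obtain g' where "is_injection g' \<beta>' G" "transports g' \<beta>' r"
      using \<open>P r \<beta>'\<close> unfolding P_def by blast
    ultimately show ?thesis
      using transports_subset[OF \<open>transitive \<beta>\<close> \<open>transitive \<beta>'\<close>]
        transports_subset[OF \<open>transitive \<beta>'\<close> \<open>transitive \<beta>\<close>] by (meson set_ext)
  qed
  have total: "\<exists>r. r \<epsilon> pow (prod G G) \<and> P r \<beta>" if "is_ordinal \<beta>" "is_injection g \<beta> G" for \<beta> g
  proof -
    let ?Q = "\<lambda>z. \<exists>x y u v. x \<epsilon> \<beta> \<and> y \<epsilon> \<beta> \<and> (x \<epsilon> y \<or> x = y) \<and> opair x u \<epsilon> g \<and> opair y v \<epsilon> g \<and> z = opair u v"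
    have "definable (\<lambda>e. ?Q (e 0))" by (intro dfn)
    note mem_sep[of ?Q, OF this, of _ "prod G G"]
    moreover have "is_fun g \<beta> G" using that unfolding is_injection_def by blast
    then have "?Q z \<Longrightarrow> z \<epsilon> prod G G" for z by (auto simp: is_fun_opair_iff is_fun_app(2))
    ultimately have "transports g \<beta> (sep (prod G G) ?Q)" "sep (prod G G) ?Q \<epsilon> pow (prod G G)"
      unfolding transports_def mem_pow subset_iff elts_iff by blast+
    then show ?thesis using that unfolding P_def by blast
  qed
  obtain B where "\<And>\<beta>. \<beta> \<epsilon> B \<longleftrightarrow> (\<exists>r. r \<epsilon> pow (prod G G) \<and> P r \<beta>)"
    by (rule replacementE[of P "pow (prod G G)", OF dfnP functional]) (assumption | blast)+
  then have "\<beta> \<epsilon> B \<longleftrightarrow> is_ordinal \<beta> \<and> (\<exists>g. is_injection g \<beta> G)" for \<beta>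
    using total unfolding P_def by blast
  then show ?thesis by (rule that)
qed

text \<open>The set of injectable ordinals is closed downward, hence an ordinal; were it injectable,
  it would belong to itself. Trichotomy leaves no other candidate for the description.\<close>

lemma mem_hartogs: "\<beta> \<epsilon> hartogs G \<longleftrightarrow> is_ordinal \<beta> \<and> (\<exists>g. is_injection g \<beta> G)"
proof -
  obtain B where B: "\<And>\<beta>. \<beta> \<epsilon> B \<longleftrightarrow> is_ordinal \<beta> \<and> (\<exists>g. is_injection g \<beta> G)"
    by (rule injectable_ordinals_setE) blast
  have ord: "is_ordinal B"
  proof -
    have "y \<epsilon> B" if yx: "y \<epsilon> x" "x \<epsilon> B" for x y
    proof -
      obtain g where x: "is_ordinal x" "is_injection g x G" using B yx(2) by blast
      have "elts y \<subseteq> elts x"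
        using x(1) yx(1) unfolding is_ordinal_def transitive_def by simp
      from is_injection_restrict[OF x(2) this] show ?thesis
        using B is_ordinal_mem[OF x(1) yx(1)] by blast
    qed
    moreover have "transitive x" if "x \<epsilon> B" for x using B that unfolding is_ordinal_def by blast
    ultimately show ?thesis unfolding is_ordinal_def transitive_def[of B] by (auto simp: subset_iff)
  qed
  then have no: "\<not> (\<exists>g. is_injection g B G)" using B[of B] by simp
  have "hartogs G = B"
    unfolding hartogs_def
  proof (rule the_equality)
    show "is_ordinal B \<and> \<not> (\<exists>f. is_injection f B G) \<and> (\<forall>\<beta>\<in>elts B. \<exists>f. is_injection f \<beta> G)"
      using ord no B by simp
    fix \<alpha> assume \<alpha>: "is_ordinal \<alpha> \<and> \<not> (\<exists>f. is_injection f \<alpha> G) \<and> (\<forall>\<beta>\<in>elts \<alpha>. \<exists>f. is_injection f \<beta> G)"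
    then show "\<alpha> = B" using ordinal_trichotomy[OF _ ord, of \<alpha>] B no by auto
  qed
  then show ?thesis using B by simp
qed

end

subsection \<open>Coding finitely many binary relations in one graph\<close>

datatype 'b vertex = Colour nat | Element 'b | Tuple nat 'b 'b

text \<open>
  Colours form a finite transitive tournament; a tuple vertex of colour \<open>i\<close> witnesses an instance of
  the \<open>i\<close>-th relation, and \<open>n\<close> is the colour of the elements.
\<close>

fun edge :: "nat \<Rightarrow> 'b vertex \<Rightarrow> 'b vertex \<Rightarrow> bool" where
  "edge n (Colour i) (Colour j) \<longleftrightarrow> i < j"
| "edge n (Colour i) (Element x) \<longleftrightarrow> i = n"
| "edge n (Colour i) (Tuple l x y) \<longleftrightarrow> i = l"
| "edge n (Element x) (Tuple l y z) \<longleftrightarrow> x = y"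
| "edge n (Tuple l y z) (Element x) \<longleftrightarrow> z = x"
| "edge n _ _ \<longleftrightarrow> False"

text \<open>A tuple vertex exists only for a true instance, so the mere presence of its image
  expresses preservation. Relation colours lie strictly below \<open>n\<close>, the colour of
  elements.\<close>

definition vertices :: "nat \<Rightarrow> 'b set \<Rightarrow> (nat \<Rightarrow> 'b \<Rightarrow> 'b \<Rightarrow> bool) \<Rightarrow> 'b vertex set" where
  "vertices n A Q = Colour ` {..n} \<union> Element ` A \<union> {Tuple i x y | i x y. i < n \<and> x \<in> A \<and> y \<in> A \<and> Q i x y}"

lemma triangle_colours:
  assumes "edge n u v" "edge n v w" "edge n u w"
    and "u \<in> vertices n A Q" "v \<in> vertices n A Q" "w \<in> vertices n A Q"
  shows "u \<in> range Colour \<and> v \<in> range Colour \<and> w \<in> range Colour"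
  using assms by (cases u; cases v; cases w) (auto simp: vertices_def)

text \<open>Upward induction gives \<open>i \<le> g i\<close>, downward induction from the bound
  \<open>n\<close> gives the converse.\<close>

lemma strict_mono_bounded_eq:
  fixes g :: "nat \<Rightarrow> nat"
  assumes mono: "\<And>i j. i < j \<Longrightarrow> j \<le> n \<Longrightarrow> g i < g j" and bound: "\<And>i. i \<le> n \<Longrightarrow> g i \<le> n" and "i \<le> n"
  shows "g i = i"
proof -
  have "i \<le> n \<Longrightarrow> i \<le> g i" for i
  proof (induction i)
    case (Suc i)
    then show ?case using mono[of i "Suc i"] by simp
  qed simp
  moreover have "g i \<le> i"
    using \<open>i \<le> n\<close>
  proof (induction i rule: inc_induct)
    case (step i)
    then show ?case using mono[of i "Suc i"] by simp
  qed (use bound in simp)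
  ultimately show ?thesis using \<open>i \<le> n\<close> by (simp add: antisym)
qed

lemma graph_endomorphism:
  assumes "2 \<le> n" and V: "\<And>v. v \<in> vertices n A Q \<Longrightarrow> H v \<in> vertices n A Q"
    and H: "\<And>u v. u \<in> vertices n A Q \<Longrightarrow> v \<in> vertices n A Q \<Longrightarrow> edge n u v \<Longrightarrow> edge n (H u) (H v)"
  shows "\<exists>j. (\<forall>x\<in>A. H (Element x) = Element (j x) \<and> j x \<in> A) \<and>
    (\<forall>i x y. i < n \<and> x \<in> A \<and> y \<in> A \<and> Q i x y \<longrightarrow> Q i (j x) (j y))"
proof -
  have colour_V: "i \<le> n \<Longrightarrow> Colour i \<in> vertices n A Q" for i by (simp add: vertices_def)
  have colour_H: "i < j \<Longrightarrow> j \<le> n \<Longrightarrow> edge n (H (Colour i)) (H (Colour j))" for i j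
    using H colour_V by simp
  have "H (Colour i) \<in> range Colour" if "i \<le> n" for i
  proof -
    \<comment> \<open>With \<open>2 \<le> n\<close> there are at least three colours, so every
      colour lies on a triangle, and triangles map to triangles.\<close>
    have *: "0 < a \<Longrightarrow> a < b \<Longrightarrow> b \<le> n \<Longrightarrow> H (Colour 0) \<in> range Colour \<and>
        H (Colour a) \<in> range Colour \<and> H (Colour b) \<in> range Colour" for a b
      by (rule triangle_colours[OF colour_H colour_H colour_H])
        (auto intro!: V colour_V)
    show ?thesis using *[of 1 2] *[of 1 i] \<open>2 \<le> n\<close> that by (cases "i = 0"; cases "i = 1") auto
  qed
  then have "\<forall>i\<in>{..n}. \<exists>k. H (Colour i) = Colour k" by blast
  then obtain g where g: "\<And>i. i \<le> n \<Longrightarrow> H (Colour i) = Colour (g i)"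
    by (metis atMost_iff)
  have "g i = i" if "i \<le> n" for i
  proof (rule strict_mono_bounded_eq[OF _ _ that])
    show "g i < g j" if "i < j" "j \<le> n" for i j using colour_H[OF that] g that by simp
    show "g i \<le> n" if "i \<le> n" for i using V[OF colour_V[OF that]] g[OF that] by (auto simp: vertices_def)
  qed
  then have fixed: "i \<le> n \<Longrightarrow> H (Colour i) = Colour i" for i using g by simp
  have "\<exists>y. H (Element x) = Element y \<and> y \<in> A" if "x \<in> A" for x
  proof -
    have x: "Element x \<in> vertices n A Q" using that by (simp add: vertices_def)
    \<comment> \<open>The last colour has no colour above it and no tuple carries it, so its
      out-neighbours are elements.\<close>
    have "edge n (Colour n) (H (Element x))" using H[OF colour_V x, of n] fixed[of n] by simp
    then show ?thesis using V[OF x] by (auto simp: vertices_def)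
  qed
  then obtain j where j: "\<And>x. x \<in> A \<Longrightarrow> H (Element x) = Element (j x) \<and> j x \<in> A" by metis
  have "Q i (j x) (j y)" if q: "i < n" "x \<in> A" "y \<in> A" "Q i x y" for i x y
  proof -
    have t: "Tuple i x y \<in> vertices n A Q" using q by (auto simp: vertices_def)
    have xy: "Element x \<in> vertices n A Q" "Element y \<in> vertices n A Q" using q by (auto simp: vertices_def)
    have "edge n (Colour i) (H (Tuple i x y))" using H[OF colour_V t, of i] fixed[of i] q(1) by simp
    moreover have "edge n (Element (j x)) (H (Tuple i x y))" "edge n (H (Tuple i x y)) (Element (j y))"
      using H[OF xy(1) t] H[OF t xy(2)] j q by simp_all
    \<comment> \<open>Only a tuple vertex has both an edge from an element and an edge to one; the
      three edges fix its colour and coordinates.\<close>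
    ultimately have "H (Tuple i x y) = Tuple i (j x) (j y)" using q(1) by (cases "H (Tuple i x y)") auto
    then show ?thesis using V[OF t] by (auto simp: vertices_def)
  qed
  then show ?thesis using j by blast
qed

context zf_universe
begin

section \<open>The coded graph as a set of the structure\<close>

definition num :: "nat \<Rightarrow> 'a" where
  "num n = (succ ^^ n) zero"

text \<open>Below a standard numeral there are only standard ones, so HOL naturals can index the
  relations even if \<open>omega\<close> is nonstandard.\<close>

lemma mem_num: "x \<epsilon> num n \<longleftrightarrow> (\<exists>i<n. x = num i)"
  by (induction n) (auto simp: num_def less_Suc_eq)

lemma num_mem_num [simp]: "num i \<epsilon> num j \<longleftrightarrow> i < j"
proof (induction j arbitrary: i)
  case 0
  then show ?case by (simp add: num_def)
next
  case (Suc j)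
  have "num i = num j \<longleftrightarrow> i = j"
    using Suc[of i] mem_num[of "num j" i] mem_irrefl[of "num j"] by (metis linorder_cases mem_num)
  then show ?case using Suc[of i] by (auto simp: num_def less_Suc_eq)
qed

lemma num_inject [simp]: "num i = num j \<longleftrightarrow> i = j"
  by (metis linorder_cases num_mem_num mem_irrefl)

primrec encode :: "'a vertex \<Rightarrow> 'a" where
  "encode (Colour i) = opair (num 0) (num i)"
| "encode (Element x) = opair (num 1) x"
| "encode (Tuple i x y) = opair (num 2) (opair (num i) (opair x y))"

lemma encode_inject [simp]: "encode u = encode v \<longleftrightarrow> u = v"
  by (cases u; cases v) auto

text \<open>Vertices are coded as tagged pairs, the edge relation is first-order in the codes, and
  an endomorphism of the resulting set graph is read back as one of the HOL graph.\<close>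

lemma relational_graphE:
  assumes "2 \<le> n" and Q: "elts Q \<subseteq> elts (prod (num n) (prod A A))"
  obtains G R where "is_graph G R" "\<And>x. x \<epsilon> A \<Longrightarrow> opair (num 1) x \<epsilon> G"
    and "\<And>h. is_endomorphism h G R \<Longrightarrow> \<exists>J. is_fun J A A \<and>
      (\<forall>x. x \<epsilon> A \<longrightarrow> app h (opair (num 1) x) = opair (num 1) (app J x)) \<and>
      (\<forall>i x y. opair i (opair x y) \<epsilon> Q \<longrightarrow> opair i (opair (app J x) (app J y)) \<epsilon> Q)"
proof -
  define Q' where "Q' i x y \<longleftrightarrow> opair (num i) (opair x y) \<epsilon> Q" for i x y
  define V where "V = vertices n (elts A) Q'"
  define G where "G = union2 (prod (upair (num 0) (num 0)) (num (Suc n)))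
    (union2 (prod (upair (num 1) (num 1)) A) (prod (upair (num 2) (num 2)) Q))"
  have Q_iff: "q \<epsilon> Q \<longleftrightarrow> (\<exists>i x y. i < n \<and> x \<epsilon> A \<and> y \<epsilon> A \<and> Q' i x y \<and> q = opair (num i) (opair x y))" for q
    using Q unfolding Q'_def subset_iff elts_iff mem_prod mem_num by blast
  have G: "z \<epsilon> G \<longleftrightarrow> (\<exists>v\<in>V. z = encode v)" for z
  proof -
    have "(\<exists>v\<in>V. z = encode v) \<longleftrightarrow> (\<exists>i\<le>n. z = encode (Colour i)) \<or>
        (\<exists>x. x \<epsilon> A \<and> z = encode (Element x)) \<or>
        (\<exists>i x y. i < n \<and> x \<epsilon> A \<and> y \<epsilon> A \<and> Q' i x y \<and> z = encode (Tuple i x y))"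
      unfolding V_def vertices_def bex_Un by (auto simp del: encode.simps)
    also have "\<dots> \<longleftrightarrow> z \<epsilon> G"
      unfolding G_def by (auto simp: mem_num Q_iff less_Suc_eq_le)
    finally show ?thesis by (rule sym)
  qed
  define E where "E u v \<longleftrightarrow>
      (\<exists>i j. u = opair (num 0) i \<and> v = opair (num 0) j \<and> i \<epsilon> j) \<or>
      (\<exists>x. u = opair (num 0) (num n) \<and> v = opair (num 1) x) \<or>
      (\<exists>i p. u = opair (num 0) i \<and> v = opair (num 2) (opair i p)) \<or>
      (\<exists>x i y. u = opair (num 1) x \<and> v = opair (num 2) (opair i (opair x y))) \<or>
      (\<exists>x i y. u = opair (num 2) (opair i (opair x y)) \<and> v = opair (num 1) y)" for u v
  have E: "E (encode u) (encode v) \<longleftrightarrow> edge n u v" for u v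
    unfolding E_def by (cases u; cases v) auto
  define R where "R = sep (prod G G) (\<lambda>z. \<exists>u v. z = opair u v \<and> E u v)"
  have "definable (\<lambda>e. \<exists>u v. e 0 = opair u v \<and> E u v)" unfolding E_def by (intro dfn)
  note mem_sep[of "\<lambda>z. \<exists>u v. z = opair u v \<and> E u v", OF this]
  then have R: "z \<epsilon> R \<longleftrightarrow> (\<exists>u v. u \<epsilon> G \<and> v \<epsilon> G \<and> z = opair u v \<and> E u v)" for z
    unfolding R_def by auto
  show ?thesis
  proof (rule that)
    show "is_graph G R" unfolding is_graph_def using R by auto
    show "opair (num 1) x \<epsilon> G" if "x \<epsilon> A" for x unfolding G_def using that by simp
    fix h assume h: "is_endomorphism h G R"
    then have h_fun: "is_fun h G G" unfolding is_endomorphism_def by blast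
    \<comment> \<open>\<open>H\<close> is a HOL function describing \<open>h\<close> through codes.
      The internal map \<open>J\<close> is obtained later, from a relation definable with parameter
      \<open>h\<close>.\<close>
    have "\<exists>w\<in>V. app h (encode v) = encode w" if "v \<in> V" for v
      using is_fun_app(2)[OF h_fun] G that by blast
    then obtain H where H: "\<And>v. v \<in> V \<Longrightarrow> H v \<in> V \<and> app h (encode v) = encode (H v)" by metis
    have "edge n (H u) (H v)" if "u \<in> V" "v \<in> V" "edge n u v" for u v
    proof -
      have "opair (encode u) (encode v) \<epsilon> R" "encode u \<epsilon> G" "encode v \<epsilon> G"
        unfolding R using that G E by blast+
      then have "opair (encode (H u)) (encode (H v)) \<epsilon> R"
        using h H that unfolding is_endomorphism_def by (metis elts_iff)
      then show ?thesis unfolding R using E by auto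
    qed
    from graph_endomorphism[OF \<open>2 \<le> n\<close>, of "elts A" Q' H, folded V_def, OF _ this] H
    have "\<exists>j. (\<forall>x\<in>elts A. H (Element x) = Element (j x) \<and> j x \<in> elts A) \<and>
      (\<forall>i x y. i < n \<and> x \<in> elts A \<and> y \<in> elts A \<and> Q' i x y \<longrightarrow> Q' i (j x) (j y))"
      by blast
    then obtain j where j: "\<And>x. x \<epsilon> A \<Longrightarrow> H (Element x) = Element (j x) \<and> j x \<epsilon> A"
      and j_Q: "\<And>i x y. i < n \<Longrightarrow> x \<epsilon> A \<Longrightarrow> y \<epsilon> A \<Longrightarrow> Q' i x y \<Longrightarrow> Q' i (j x) (j y)"
      unfolding Ball_def elts_iff by blast
    have V_A: "Element x \<in> V" if "x \<epsilon> A" for x using that by (simp add: V_def vertices_def)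
    have h_A: "app h (opair (num 1) x) = opair (num 1) (j x)" if "x \<epsilon> A" for x
      using H[OF V_A[OF that]] j[OF that] by simp
    obtain J where J: "is_fun J A A" "\<And>x. x \<epsilon> A \<Longrightarrow> app J x = j x"
    proof (rule functionE[of "\<lambda>x y. opair (opair (num 1) x) (opair (num 1) y) \<epsilon> h" A j A])
      show "definable (\<lambda>e. opair (opair (num 1) (e k)) (opair (num 1) (e l)) \<epsilon> h)" for k l
        by (intro dfn)
      show "j x \<epsilon> A" if "x \<epsilon> A" for x using j[OF that] by blast
      show "opair (opair (num 1) x) (opair (num 1) y) \<epsilon> h \<longleftrightarrow> y = j x" if "x \<epsilon> A" for x y
        unfolding is_fun_opair_iff[OF h_fun] using h_A[OF that] that by (simp add: G_def)
    qed blast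
    have "opair i (opair (app J x) (app J y)) \<epsilon> Q" if ixy: "opair i (opair x y) \<epsilon> Q" for i x y
    proof -
      obtain l where "i = num l" "l < n" "x \<epsilon> A" "y \<epsilon> A" "Q' l x y" using ixy unfolding Q_iff by auto
      then show ?thesis using j_Q J(2) unfolding Q'_def by simp
    qed
    then show "\<exists>J. is_fun J A A \<and>
      (\<forall>x. x \<epsilon> A \<longrightarrow> app h (opair (num 1) x) = opair (num 1) (app J x)) \<and>
      (\<forall>i x y. opair i (opair x y) \<epsilon> Q \<longrightarrow> opair i (opair (app J x) (app J y)) \<epsilon> Q)"
      using J h_A by (intro exI[of _ J]) simp
  qed
qed

text \<open>
  Preserving the first four relations forces a map to fix every formula; the last one makes it act on
  assignments by composition.
\<close>

definition structure_relation :: "'a \<Rightarrow> 'a \<Rightarrow> 'a \<Rightarrow> 'a \<Rightarrow> bool" where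
  "structure_relation M i x y \<longleftrightarrow>
    i = num 0 \<and> (\<exists>v. x = opair y v) \<or>
    i = num 1 \<and> (\<exists>v. x = opair v y) \<or>
    i = num 2 \<and> x = zero \<and> y = zero \<or>
    i = num 3 \<and> x \<epsilon> omega \<and> y = succ x \<or>
    i = num 4 \<and> opair x y \<epsilon> sat_set M \<or>
    i = num 5 \<and> x \<epsilon> y \<and> is_fun y omega M"

lemma structure_relation_simps:
  "structure_relation M (num 0) x y \<longleftrightarrow> (\<exists>v. x = opair y v)"
  "structure_relation M (num 1) x y \<longleftrightarrow> (\<exists>v. x = opair v y)"
  "structure_relation M (num 2) x y \<longleftrightarrow> x = zero \<and> y = zero"
  "structure_relation M (num 3) x y \<longleftrightarrow> x \<epsilon> omega \<and> y = succ x"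
  "structure_relation M (num 4) x y \<longleftrightarrow> opair x y \<epsilon> sat_set M"
  "structure_relation M (num 5) x y \<longleftrightarrow> x \<epsilon> y \<and> is_fun y omega M"
  by (auto simp: structure_relation_def)

section \<open>From endomorphisms to proto Berkeley cardinals\<close>

lemma structure_endomorphism_elementary:
  assumes A: "elts (union2 omega (union2 M (funs omega M))) \<subseteq> elts A"
      "\<And>x y. x \<epsilon> A \<Longrightarrow> y \<epsilon> A \<Longrightarrow> opair x y \<epsilon> A"
    and J: "is_fun J A A"
    and rel: "\<And>i x y. i < 6 \<Longrightarrow> x \<epsilon> A \<Longrightarrow> y \<epsilon> A \<Longrightarrow> structure_relation M (num i) x y \<Longrightarrow>
      structure_relation M (num i) (app J x) (app J y)"
  obtains j where "elementary_embedding j M M" "\<And>x. x \<epsilon> M \<Longrightarrow> app j x = app J x"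
proof -
  have in_A: "n \<epsilon> omega \<Longrightarrow> n \<epsilon> A" "x \<epsilon> M \<Longrightarrow> x \<epsilon> A" "is_fun a omega M \<Longrightarrow> a \<epsilon> A" for n x a
    using A(1) by (auto simp: subset_iff)
  have formula_A: "p \<epsilon> A" if "is_formula p" for p
  proof -
    have "elts omega \<subseteq> elts A" using in_A(1) by auto
    then have "formula_closed A" using A(2) by (rule formula_closed_opair_closed)
    then show ?thesis using that unfolding is_formula_def by blast
  qed
  \<comment> \<open>Relations 0 and 1 are the projections: preserving the first makes the image a
    pair with first entry \<open>app J x\<close>, preserving the second gives its second
    entry.\<close>
  have J_opair: "app J (opair x y) = opair (app J x) (app J y)" if "x \<epsilon> A" "y \<epsilon> A" for x y
    using rel[of 0 "opair x y" x] rel[of 1 "opair x y" y] A(2)[OF that] that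
    unfolding structure_relation_simps by auto
  \<comment> \<open>Being fixed is phrased as membership of a diagonal pair in \<open>J\<close>,
    which is first-order and so allows the inductions below.\<close>
  have J_opair_fix: "opair (opair x y) (opair x y) \<epsilon> J" if "opair x x \<epsilon> J" "opair y y \<epsilon> J" for x y
    using that A(2)[of x y] J_opair[of x y] unfolding is_fun_opair_iff[OF J] by auto
  have J_omega: "opair n n \<epsilon> J" if "n \<epsilon> omega" for n
  proof -
    have "definable (\<lambda>e. opair (e 0) (e 0) \<epsilon> J)" by (intro dfn)
    from this that show ?thesis
    proof (induction rule: omega_induct)
      case zero
      show ?case using rel[of 2 zero zero] in_A(1) unfolding structure_relation_simps is_fun_opair_iff[OF J] by simp
    next
      case (succ n)
      then show ?case
        using rel[of 3 n "succ n"] in_A(1) unfolding structure_relation_simps is_fun_opair_iff[OF J] by simp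
    qed
  qed
  have J_formula: "app J p = p" if "is_formula p" for p
  proof -
    have "definable (\<lambda>e. opair (e 0) (e 0) \<epsilon> J)" by (intro dfn)
    from this that have "opair p p \<epsilon> J"
      by (induction rule: formula_induct) (simp_all add: code_defs J_opair_fix J_omega)
    then show ?thesis unfolding is_fun_opair_iff[OF J] by simp
  qed
  have J_pair_mem: "is_fun (app J a) omega M \<and> opair n (app J x) \<epsilon> app J a"
    if "is_fun a omega M" "opair n x \<epsilon> a" for a n x
  proof -
    have nx: "n \<epsilon> omega" "x \<epsilon> M"
      using that(2) is_fun_app(2)[OF that(1)] unfolding is_fun_opair_iff[OF that(1)] by auto
    have "app J n = n" using J_omega[OF nx(1)] unfolding is_fun_opair_iff[OF J] by simp
    then show ?thesis
      using rel[of 5 "opair n x" a] that in_A nx A(2) J_opair[of n x]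
      unfolding structure_relation_simps by auto
  qed
  have J_app: "is_fun (app J a) omega M" "n \<epsilon> omega \<Longrightarrow> app (app J a) n = app J (app a n)"
    if a: "is_fun a omega M" for a n
  proof -
    \<comment> \<open>An assignment contains a pair at \<open>zero\<close>, which supplies an
      instance of relation 5.\<close>
    show *: "is_fun (app J a) omega M" using J_pair_mem[OF a is_fun_app(1)[OF a zero_omega]] by blast
    show "app (app J a) n = app J (app a n)" if "n \<epsilon> omega"
      using J_pair_mem[OF a is_fun_app(1)[OF a that]] is_fun_opair_iff[OF *] by simp
  qed
  have J_M: "app J x \<epsilon> M" if "x \<epsilon> M" for x
  proof -
    \<comment> \<open>\<open>x\<close> is a value of a constant assignment, and the image of that
      assignment again takes values in \<open>M\<close>.\<close>
    note a = is_fun_constant[OF that, of omega]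
    show ?thesis
      using J_app(2)[OF a zero_omega] is_fun_app(2)[OF J_app(1)[OF a] zero_omega] app_constant[OF that zero_omega]
      by simp
  qed
  obtain j where j: "is_fun j M M" "\<And>x. x \<epsilon> M \<Longrightarrow> app j x = app J x"
  proof (rule functionE[of "\<lambda>x y. opair x y \<epsilon> J" M "app J" M])
    show "definable (\<lambda>e. opair (e k) (e l) \<epsilon> J)" for k l by (intro dfn)
    show "opair x y \<epsilon> J \<longleftrightarrow> y = app J x" if "x \<epsilon> M" for x y
      unfolding is_fun_opair_iff[OF J] using in_A(2)[OF that] by simp
  qed (use J_M in blast)+
  have sat_J: "satisfies M p (app J a)" if "is_formula p" "is_fun a omega M" "satisfies M p a" for p a
    using rel[of 4 p a] that formula_A in_A(3) J_formula J_app(1)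
    unfolding structure_relation_simps by (simp add: satisfies_iff)
  have "elementary_embedding j M M"
    unfolding elementary_embedding_def
  proof (intro conjI allI impI)
    show "is_fun j M M" by (fact j(1))
    fix p a b
    assume *: "is_formula p \<and> is_fun a omega M \<and> is_fun b omega M \<and>
      (\<forall>k\<in>elts omega. app b k = app j (app a k))"
    have "b = app J a"
    proof (rule fun_ext[of _ omega M _ M])
      show "is_fun (app J a) omega M" using J_app(1) * by blast
      show "app b k = app (app J a) k" if "k \<epsilon> omega" for k
        using * that J_app(2)[of a k] j(2)[OF is_fun_app(2)[of a omega M k]] by simp
    qed (use * in blast)
    \<comment> \<open>Relation 4 is preserved in one direction only; applying it to the negation
      supplies the other.\<close>
    moreover have "satisfies M (code_neg p) a \<longleftrightarrow> \<not> satisfies M p a"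
      "satisfies M (code_neg p) (app J a) \<longleftrightarrow> \<not> satisfies M p (app J a)"
      using satisfies_code(3) * J_app(1) by blast+
    ultimately show "satisfies M p a \<longleftrightarrow> satisfies M p b"
      using sat_J[of p a] sat_J[of "code_neg p" a] * by auto
  qed
  then show ?thesis using that j(2) by blast
qed

lemma proto_berkeleyI:
  assumes "is_cardinal \<delta>"
    and graphs: "\<And>G R f. is_graph G R \<Longrightarrow> \<delta> \<epsilon> hartogs G \<Longrightarrow> is_injection f \<delta> G \<Longrightarrow>
      \<exists>h. is_endomorphism h G R \<and> (\<exists>y\<in>app f ` elts \<delta>. app h y \<noteq> y)"
  shows "proto_berkeley \<delta>"
proof -
  have ordinal: "is_ordinal \<delta>" using \<open>is_cardinal \<delta>\<close> unfolding is_cardinal_def by blast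
  then have \<delta>_trans: "transitive \<delta>" unfolding is_ordinal_def by blast
  have "\<exists>j. elementary_embedding j M M \<and> (\<exists>x\<in>elts M. app j x \<noteq> x) \<and>
      (\<exists>\<kappa>. is_critical_point j M \<kappa> \<and> \<kappa> \<epsilon> \<delta>)" if M: "transitive M" "\<delta> \<epsilon> M" for M
  proof -
    obtain A where A: "elts (union2 omega (union2 M (funs omega M))) \<subseteq> elts A"
      "\<And>x y. x \<epsilon> A \<Longrightarrow> y \<epsilon> A \<Longrightarrow> opair x y \<epsilon> A"
      by (rule opair_closureE) blast
    have \<delta>_M: "\<alpha> \<epsilon> M" if "\<alpha> \<epsilon> \<delta>" for \<alpha> using transitive_memD[OF M(1) that M(2)] .
    have M_A: "x \<epsilon> A" if "x \<epsilon> M" for x using A(1) that by (auto simp: subset_iff)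
    let ?Q = "\<lambda>q. \<exists>i x y. q = opair i (opair x y) \<and> structure_relation M i x y"
    \<comment> \<open>The six relations become one set of triples tagged by their index.\<close>
    define Q where "Q = sep (prod (num 6) (prod A A)) ?Q"
    have "definable (\<lambda>e. ?Q (e 0))" unfolding structure_relation_def by (intro dfn)
    note mem_sep[of ?Q, OF this, of _ "prod (num 6) (prod A A)", folded Q_def]
    then have Q: "opair i (opair x y) \<epsilon> Q \<longleftrightarrow> i \<epsilon> num 6 \<and> x \<epsilon> A \<and> y \<epsilon> A \<and> structure_relation M i x y"
      and Q_sub: "elts Q \<subseteq> elts (prod (num 6) (prod A A))" for i x y
      by (auto simp: subset_iff)
    obtain G R where G: "is_graph G R" "\<And>x. x \<epsilon> A \<Longrightarrow> opair (num 1) x \<epsilon> G"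
      and endo: "\<And>h. is_endomorphism h G R \<Longrightarrow> \<exists>J. is_fun J A A \<and>
        (\<forall>x. x \<epsilon> A \<longrightarrow> app h (opair (num 1) x) = opair (num 1) (app J x)) \<and>
        (\<forall>i x y. opair i (opair x y) \<epsilon> Q \<longrightarrow> opair i (opair (app J x) (app J y)) \<epsilon> Q)"
      by (rule relational_graphE[OF _ Q_sub]) (simp, blast)
    \<comment> \<open>Each ordinal below \<delta> goes to its element vertex, so moving a value of
      \<open>f\<close> means that \<open>J\<close> moves an ordinal below \<delta>.\<close>
    obtain f where f: "is_fun f \<delta> G" "\<And>\<alpha>. \<alpha> \<epsilon> \<delta> \<Longrightarrow> app f \<alpha> = opair (num 1) \<alpha>"
    proof (rule functionE[of "\<lambda>x y. y = opair (num 1) x" \<delta> "opair (num 1)" G])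
      show "definable (\<lambda>e. e l = opair (num 1) (e k))" for k l by (intro dfn)
    qed (use G(2) M_A \<delta>_M in blast)+
    then have inj: "is_injection f \<delta> G" unfolding is_injection_def inj_on_def by simp
    then have "\<delta> \<epsilon> hartogs G" using mem_hartogs ordinal by blast
    from graphs[OF G(1) this inj] obtain h \<alpha> where h: "is_endomorphism h G R"
      and \<alpha>: "\<alpha> \<epsilon> \<delta>" "app h (app f \<alpha>) \<noteq> app f \<alpha>" by auto
    obtain J where J: "is_fun J A A"
      "\<And>x. x \<epsilon> A \<Longrightarrow> app h (opair (num 1) x) = opair (num 1) (app J x)"
      "\<And>i x y. opair i (opair x y) \<epsilon> Q \<Longrightarrow> opair i (opair (app J x) (app J y)) \<epsilon> Q"
      using endo[OF h] by blast
    have rel: "structure_relation M (num i) (app J x) (app J y)"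
      if "i < 6" "x \<epsilon> A" "y \<epsilon> A" "structure_relation M (num i) x y" for i x y
      using J(3)[of "num i" x y] that unfolding Q by simp
    obtain j where j: "elementary_embedding j M M" "\<And>x. x \<epsilon> M \<Longrightarrow> app j x = app J x"
      by (rule structure_endomorphism_elementary[OF A J(1) rel]) (assumption | blast)+
    have "\<not> opair \<alpha> \<alpha> \<epsilon> J"
      using \<alpha> J(2) f(2) M_A \<delta>_M unfolding is_fun_opair_iff[OF J(1)] by simp
    \<comment> \<open>Foundation yields a membership-minimal moved ordinal, the candidate for the
      critical point.\<close>
    moreover have "definable (\<lambda>e. \<not> opair (e 0) (e 0) \<epsilon> J)" by (intro dfn)
    note foundationE[of "\<lambda>\<alpha>. \<not> opair \<alpha> \<alpha> \<epsilon> J", OF this \<alpha>(1)]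
    ultimately obtain \<kappa> where \<kappa>: "\<kappa> \<epsilon> \<delta>" "\<not> opair \<kappa> \<kappa> \<epsilon> J"
      "\<And>\<beta>. \<beta> \<epsilon> \<kappa> \<Longrightarrow> \<beta> \<epsilon> \<delta> \<Longrightarrow> opair \<beta> \<beta> \<epsilon> J"
      by (metis (no_types, lifting))
    have "app j \<kappa> \<noteq> \<kappa>"
      using \<kappa>(1,2) j(2) \<delta>_M M_A unfolding is_fun_opair_iff[OF J(1)] by simp
    moreover have "app j \<beta> = \<beta>" if "\<beta> \<epsilon> \<kappa>" for \<beta>
    proof -
      \<comment> \<open>Minimality speaks about members of \<delta>; transitivity of \<delta> places
        every member of \<kappa> there.\<close>
      have "\<beta> \<epsilon> \<delta>" using transitive_memD[OF \<delta>_trans that \<kappa>(1)] .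
      then show ?thesis using \<kappa>(3)[OF that] j(2) \<delta>_M unfolding is_fun_opair_iff[OF J(1)] by simp
    qed
    ultimately have "is_critical_point j M \<kappa>"
      unfolding is_critical_point_def using is_ordinal_mem[OF ordinal \<kappa>(1)] \<delta>_M[OF \<kappa>(1)] by blast
    moreover have "\<exists>x\<in>elts M. app j x \<noteq> x"
      using \<open>app j \<kappa> \<noteq> \<kappa>\<close> \<delta>_M[OF \<kappa>(1)] by auto
    ultimately show ?thesis using j(1) \<kappa>(1) by blast
  qed
  then show ?thesis unfolding proto_berkeley_def using \<open>is_cardinal \<delta>\<close> by blast
qed

end

theorem theorem5p1:
  fixes mem :: "'a \<Rightarrow> 'a \<Rightarrow> bool" and \<delta> :: 'a
  assumes "zf mem"
    and "membership.is_cardinal mem \<delta>"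
  shows "membership.proto_berkeley mem \<delta> \<longleftrightarrow>
    (\<forall>G R f. membership.is_graph mem G R \<and>
       mem \<delta> (membership.hartogs mem G) \<and>
       membership.is_injection mem f \<delta> G \<longrightarrow>
       (\<exists>h. membership.is_endomorphism mem h G R \<and>
          (\<exists>y \<in> membership.app mem f ` membership.elts mem \<delta>. membership.app mem h y \<noteq> y)))"
proof -
  interpret zf_universe mem by (rule zf_universe.intro) (fact assms(1))
  show ?thesis
  proof (intro iffI allI impI)
    fix G R f assume "proto_berkeley \<delta>" and "is_graph G R \<and> mem \<delta> (hartogs G) \<and> is_injection f \<delta> G"
    then show "\<exists>h. is_endomorphism h G R \<and> (\<exists>y\<in>app f ` elts \<delta>. app h y \<noteq> y)"
      by (intro proto_berkeley_endomorphism) auto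
  next
    assume "\<forall>G R f. is_graph G R \<and> mem \<delta> (hartogs G) \<and> is_injection f \<delta> G \<longrightarrow>
      (\<exists>h. is_endomorphism h G R \<and> (\<exists>y\<in>app f ` elts \<delta>. app h y \<noteq> y))"
    then show "proto_berkeley \<delta>" by (intro proto_berkeleyI[OF assms(2)]) simp
  qed
qed

end
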